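(* Let $X$ be a real Banach space, let $K$ be a generating subset of $X$, and let $\beta=(e_n)_{n\in\mathbb{N}}\subset \operatorname{span}(K)$ be a fundamental sequence of $X$ such that $K$ is $\beta$-flat and has nonempty local $\beta$-interior. If there exists a Lipschitz retraction from $X$ onto $K$, then $X$ has the bounded approximation property.
   Context: For vectors $e_1,\dots,e_n$ of a Banach space, $[e_i]_{i=1}^n$ denotes their linear span. A subset $C$ of a Banach space $X$ is called generating if the closed linear span of $C$ is $X$. A sequence $\beta=(e_n)_{n\in\mathbb{N}}$ in $X$ is fundamental if its closed linear span is $X$ (so $X$ is separable). Let $K\subset X$ be a bounded generating set and $\beta=(e_n)_{n\in\mathbb{N}}\subset \operatorname{span}(K)$ a fundamental sequence of $X$. The heights of $K$ relative to $\beta$ are $$h_n^\beta=\sup\{d(x,[e_i]_{i=1}^n) : x\in K\},\qquad n\in\mathbb{N}.$$ The set $K$ is called $\beta$-flat if there exists $\varepsilon>0$ such that $\liminf_{n} h_n^\beta(3+\varepsilon)^n=0$; in particular, saying that $K$ is $\beta$-flat includes that $K$ is bounded. A subset $C\subset X$ has nonempty local $\beta$-interior if, for every $n\in\mathbb{N}$, the set $C\cap[e_i]_{i=1}^n$ has nonempty interior in the relative topology of $[e_i]_{i=1}^n$. A Lipschitz retraction from $X$ onto a subset $K$ is a map $R:X\to K$ with $R(x)=x$ for all $x\in K$ for which there is $\lambda>0$ with $\|R(x)-R(y)\|\le\lambda\|x-y\|$ for all $x,y\in X$. $X$ has the bounded approximation property (BAP) if there is a uniformly bounded net $(T_\alpha)$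 of finite rank bounded linear operators on $X$ tending strongly (i.e. pointwise in norm) to the identity on $X$. *)

theory Defs
  imports "HOL-Analysis.Analysis"
begin

text \<open>
  The Banach space \<open>X\<close> is the whole type \<^typ>\<open>'a::banach\<close>. Sequences are indexed by
  \<open>1, 2, 3, \<dots>\<close>; the value at \<open>0\<close> of a sequence \<^typ>\<open>nat \<Rightarrow> 'a\<close> is never used.
\<close>

definition generating :: "'a::real_normed_vector set \<Rightarrow> bool" where
  "generating C \<longleftrightarrow> closure (span C) = UNIV"

definition fundamental :: "(nat \<Rightarrow> 'a::real_normed_vector) \<Rightarrow> bool" where
  "fundamental e \<longleftrightarrow> closure (span (e ` {1..})) = UNIV"

definition initial_span :: "(nat \<Rightarrow> 'a::real_vector) \<Rightarrow> nat \<Rightarrow> 'a set" where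
  "initial_span e n = span (e ` {1..n})"

text \<open>
  The supremum is taken in the reals, so it is meaningful only for bounded nonempty \<open>K\<close>.
  Boundedness is part of flatness below, and nonemptiness follows from nonempty local interior.
\<close>

definition height :: "(nat \<Rightarrow> 'a::real_normed_vector) \<Rightarrow> 'a set \<Rightarrow> nat \<Rightarrow> real" where
  "height e K n = (SUP x\<in>K. infdist x (initial_span e n))"

definition flat :: "(nat \<Rightarrow> 'a::real_normed_vector) \<Rightarrow> 'a set \<Rightarrow> bool" where
  "flat e K \<longleftrightarrow> bounded K \<and>
     (\<exists>\<epsilon>>0. liminf (\<lambda>n. ereal (height e K n * (3 + \<epsilon>) ^ n)) = 0)"

definition nonempty_local_interior :: "(nat \<Rightarrow> 'a::real_normed_vector) \<Rightarrow> 'a set \<Rightarrow> bool" where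
  "nonempty_local_interior e C \<longleftrightarrow>
     (\<forall>n\<ge>1. top_of_set (initial_span e n) interior_of (C \<inter> initial_span e n) \<noteq> {})"

definition lipschitz_retraction :: "('a::real_normed_vector \<Rightarrow> 'a) \<Rightarrow> 'a set \<Rightarrow> bool" where
  "lipschitz_retraction R K \<longleftrightarrow>
     R ` UNIV \<subseteq> K \<and> (\<forall>x\<in>K. R x = x) \<and> (\<exists>L>0. L-lipschitz_on UNIV R)"

definition finite_rank :: "('a::real_normed_vector \<Rightarrow>\<^sub>L 'b::real_normed_vector) \<Rightarrow> bool" where
  "finite_rank T \<longleftrightarrow> (\<exists>B. finite B \<and> range (blinfun_apply T) \<subseteq> span B)"

definition directed_set :: "'i set \<Rightarrow> ('i \<Rightarrow> 'i \<Rightarrow> bool) \<Rightarrow> bool" where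
  "directed_set I le \<longleftrightarrow> I \<noteq> {} \<and> reflp_on I le \<and> transp_on I le \<and>
     (\<forall>i\<in>I. \<forall>j\<in>I. \<exists>k\<in>I. le i k \<and> le j k)"

definition net_tendsto ::
    "'i set \<Rightarrow> ('i \<Rightarrow> 'i \<Rightarrow> bool) \<Rightarrow> ('i \<Rightarrow> 'a::topological_space) \<Rightarrow> 'a \<Rightarrow> bool" where
  "net_tendsto I le f l \<longleftrightarrow>
     (\<forall>U. open U \<and> l \<in> U \<longrightarrow> (\<exists>i\<in>I. \<forall>j\<in>I. le i j \<longrightarrow> f j \<in> U))"

definition bap_net ::
    "'i set \<Rightarrow> ('i \<Rightarrow> 'i \<Rightarrow> bool) \<Rightarrow> ('i \<Rightarrow> ('a::real_normed_vector \<Rightarrow>\<^sub>L 'a)) \<Rightarrow> bool" where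
  "bap_net I le T \<longleftrightarrow> directed_set I le \<and>
     (\<forall>i\<in>I. finite_rank (T i)) \<and>
     (\<exists>C. \<forall>i\<in>I. norm (T i) \<le> C) \<and>
     (\<forall>x. net_tendsto I le (\<lambda>i. blinfun_apply (T i) x) x)"

text \<open>
  HOL cannot quantify over the type of indices inside a definition, so the index type is fixed.
  The lemma \<open>bapI\<close> shows that this loses no generality: a net with indices of an arbitrary
  type can be replaced by one indexed by pairs of a finite set of points and a precision.
\<close>

definition bounded_approximation_property :: "'a::real_normed_vector itself \<Rightarrow> bool" where
  "bounded_approximation_property _ \<longleftrightarrow>
     (\<exists>(I :: ('a set \<times> nat) set) le (T :: 'a set \<times> nat \<Rightarrow> ('a \<Rightarrow>\<^sub>L 'a)). bap_net I le T)"

lemma bapI: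
  fixes T :: "'i \<Rightarrow> ('a::real_normed_vector \<Rightarrow>\<^sub>L 'a)"
  assumes "bap_net I le T"
  shows "bounded_approximation_property TYPE('a)"
proof -
  obtain C where I: "I \<noteq> {}" "reflp_on I le" "transp_on I le"
      "\<And>i j. i \<in> I \<Longrightarrow> j \<in> I \<Longrightarrow> \<exists>k\<in>I. le i k \<and> le j k"
    and fr: "\<And>i. i \<in> I \<Longrightarrow> finite_rank (T i)"
    and C: "\<And>i. i \<in> I \<Longrightarrow> norm (T i) \<le> C"
    and lim: "\<And>x. net_tendsto I le (\<lambda>i. blinfun_apply (T i) x) x"
    using assms unfolding bap_net_def directed_set_def by blast
  have ball: "\<exists>i\<in>I. \<forall>j\<in>I. le i j \<longrightarrow> dist x (blinfun_apply (T j) x) < d" if "d > 0" for x d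
    using lim[of x] that unfolding net_tendsto_def
    by (metis centre_in_ball mem_ball open_ball)
  have ev: "\<exists>i\<in>I. \<forall>j\<in>I. le i j \<longrightarrow> (\<forall>x\<in>F. dist x (blinfun_apply (T j) x) < d)"
    if fin: "finite F" and d: "d > 0" for F d
    using fin
  proof (induction F)
    case empty
    then show ?case using I(1) by blast
  next
    case (insert x F)
    obtain i where i: "i \<in> I" "\<forall>j\<in>I. le i j \<longrightarrow> (\<forall>x\<in>F. dist x (blinfun_apply (T j) x) < d)"
      using insert.IH by blast
    obtain k where k: "k \<in> I" "\<forall>j\<in>I. le k j \<longrightarrow> dist x (blinfun_apply (T j) x) < d"
      using ball d by blast
    obtain m where m: "m \<in> I" "le i m" "le k m"
      using I(4) i(1) k(1) by blast
    have "\<forall>j\<in>I. le m j \<longrightarrow> le i j \<and> le k j"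
      using I(3) i(1) k(1) m unfolding transp_on_def by blast
    then show ?case using i(2) k(2) m(1) by (metis insert_iff)
  qed
  define J where "J = {p :: 'a set \<times> nat. finite (fst p)}"
  define leJ where "leJ p q \<longleftrightarrow> fst p \<subseteq> fst q \<and> snd p \<le> snd q" for p q :: "'a set \<times> nat"
  have "\<exists>S. S \<in> T ` I \<and> (\<forall>x\<in>fst p. dist x (blinfun_apply S x) < 1 / Suc (snd p))"
    if p: "p \<in> J" for p
  proof -
    obtain i where "i \<in> I"
        "\<forall>j\<in>I. le i j \<longrightarrow> (\<forall>x\<in>fst p. dist x (blinfun_apply (T j) x) < 1 / Suc (snd p))"
      using ev[of "fst p" "1 / Suc (snd p)"] p unfolding J_def by auto
    moreover from this have "le i i" using I(2) unfolding reflp_on_def by blast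
    ultimately show ?thesis by blast
  qed
  then obtain S where S: "\<And>p. p \<in> J \<Longrightarrow> S p \<in> T ` I"
    "\<And>p x. p \<in> J \<Longrightarrow> x \<in> fst p \<Longrightarrow> dist x (blinfun_apply (S p) x) < 1 / Suc (snd p)"
    by metis
  have "directed_set J leJ"
    unfolding directed_set_def
  proof (intro conjI ballI)
    show "J \<noteq> {}" unfolding J_def by (metis (mono_tags) empty_iff finite.emptyI fst_conv mem_Collect_eq)
    show "reflp_on J leJ" "transp_on J leJ"
      unfolding leJ_def reflp_on_def transp_on_def by auto
    fix p q assume "p \<in> J" "q \<in> J"
    then show "\<exists>r\<in>J. leJ p r \<and> leJ q r"
      unfolding J_def leJ_def
      by (intro bexI[of _ "(fst p \<union> fst q, max (snd p) (snd q))"]) auto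
  qed
  moreover have "net_tendsto J leJ (\<lambda>p. blinfun_apply (S p) x) x" for x
    unfolding net_tendsto_def
  proof (intro allI impI)
    fix U assume "open U \<and> x \<in> U"
    then obtain d where d: "d > 0" "ball x d \<subseteq> U" using open_contains_ball by blast
    obtain n where n: "1 / Suc n < d" using d(1) by (meson nat_approx_posE)
    show "\<exists>i\<in>J. \<forall>j\<in>J. leJ i j \<longrightarrow> blinfun_apply (S j) x \<in> U"
    proof (intro bexI[of _ "({x}, n)"] ballI impI)
      show "({x}, n) \<in> J" unfolding J_def by simp
      fix j assume j: "j \<in> J" "leJ ({x}, n) j"
      then have "dist x (blinfun_apply (S j) x) < 1 / Suc (snd j)"
        using S(2) unfolding leJ_def by auto
      also have "\<dots> \<le> 1 / Suc n"
        using j(2) unfolding leJ_def by (simp add: frac_le)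
      finally show "blinfun_apply (S j) x \<in> U" using n d(2) by auto
    qed
  qed
  ultimately have "bap_net J leJ S"
    unfolding bap_net_def using S(1) fr C by (metis imageE)
  then show ?thesis unfolding bounded_approximation_property_def by blast
qed

end

theory Submission
  imports Defs "HOL-Library.Function_Algebras"
begin

text \<open>
  Write \<open>E\<^sub>n\<close> for the span of \<open>e\<^sub>1, \<dots>, e\<^sub>n\<close> and let \<open>R\<close> be an \<open>L\<close>-Lipschitz retraction onto \<open>K\<close>. It suffices
  to find, for every \<open>m\<close>, a finite rank operator that is the identity on \<open>E\<^sub>m\<close>, with a bound on the
  norms that does not depend on \<open>m\<close>: the union of the \<open>E\<^sub>m\<close> is dense, so these operators converge
  strongly to the identity.

  Fix \<open>m\<close>. The retraction is the identity on a ball of \<open>E\<^sub>m\<close> inside \<open>K\<close>, and for suitable \<open>n\<close> its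
  values lie within a tiny distance \<open>H\<close> of \<open>E\<^sub>n\<close>. Move the values of \<open>R\<close> into \<open>E\<^sub>n\<close> by a continuous
  map at the cost of an error \<open>2H\<close>, and average the result over segments of half-length \<open>2H\<close> in
  finitely many prescribed unit directions and over longer segments in directions spanning \<open>E\<^sub>m\<close>. The
  averaged function has a derivative that is linear on the span of all these directions. This
  derivative maps into \<open>E\<^sub>n\<close>, its norm in a prescribed direction is at most \<open>L + 1\<close>, because an error
  of size \<open>2H\<close> is divided by a length of the same size, and it almost fixes \<open>E\<^sub>m\<close>, provided that \<open>H\<close>
  times the number of directions is small compared with the radius of the ball in \<open>E\<^sub>m\<close>
  (lemma \<open>linear_from_retraction\<close>).

  These linear maps are defined only on finite-dimensional spaces, which moreover depend on the
  prescribed directions. Duality turns them into one operator on \<open>X\<close>. Choose finitely many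
  functionals \<open>f\<^sub>y\<close> of norm at most one with \<open>(1 - \<delta>) \<parallel>v\<parallel> \<le> max\<^sub>y \<bar>f\<^sub>y v\<bar>\<close> on \<open>E\<^sub>n\<close>. An
  operator \<open>T : X \<rightarrow> E\<^sub>n\<close> that fixes \<open>E\<^sub>m\<close> and satisfies \<open>\<bar>f\<^sub>y (T u)\<bar> \<le> C \<parallel>u\<parallel>\<close> exists, by the
  Hahn-Banach theorem, as soon as the trace of every tensor \<open>\<Sum> f\<^sub>y \<otimes> x\<^sub>y\<close> that maps \<open>E\<^sub>n\<close> into \<open>E\<^sub>m\<close>
  is at most \<open>C \<Sum> \<parallel>x\<^sub>y\<parallel>\<close> (lemma \<open>operator_from_trace_estimate\<close>). A single tensor involves only as
  many directions \<open>x\<^sub>y\<close> as there are functionals, and for such a finite family the derivative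
  constructed above proves the trace inequality (lemma \<open>trace_estimate\<close>). In the formal version a tensor
  also carries a remainder with one vector for each of \<open>e\<^sub>1, \<dots>, e\<^sub>n\<close>, which adds at most \<open>n\<close> directions.

  It remains to count. The functionals come from a \<open>\<delta>\<close>-net of the unit sphere of \<open>E\<^sub>n\<close>, which may be
  taken with at most \<open>(1 + 2/\<delta>)\<^sup>n\<close> points (lemma \<open>finite_net\<close>). A suitable \<open>\<delta> < 1\<close> makes this
  \<open>(3 + \<epsilon>/2)\<^sup>n\<close>, and flatness makes \<open>H\<close> times this number as small as required. The resulting
  operators have norm at most \<open>(L + 2) / (1 - \<delta>)\<close>, whatever \<open>m\<close> is.
\<close>

section \<open>Extension of dominated functionals\<close>

text \<open>
  The graphs of dominated extensions are subspaces of \<open>V \<times> \<real>\<close> lying below the graph of \<open>p\<close>. Such a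
  subspace is automatically a graph, so Zorn's lemma applies to subspaces ordered by inclusion.
\<close>

lemma hahn_banach_dominated:
  fixes p f :: "'v::real_vector \<Rightarrow> real"
  assumes sub: "\<And>x y. p (x + y) \<le> p x + p y"
    and hom: "\<And>t x. t \<ge> 0 \<Longrightarrow> p (t *\<^sub>R x) = t * p x"
    and S: "subspace S" and f: "linear f" and fp: "\<And>x. x \<in> S \<Longrightarrow> f x \<le> p x"
  shows "\<exists>F. linear F \<and> (\<forall>x\<in>S. F x = f x) \<and> (\<forall>x. F x \<le> p x)"
proof -
  define \<A> where "\<A> = {G :: ('v \<times> real) set. subspace G \<and> (\<forall>x\<in>S. (x, f x) \<in> G) \<and> (\<forall>x a. (x, a) \<in> G \<longrightarrow> a \<le> p x)}"
  have p0: "p 0 = 0" using hom[of 0 0] by simp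
  have "(\<lambda>x. (x, f x)) ` S \<in> \<A>"
  proof -
    have "linear (\<lambda>x. (x, f x))"
      using f by (auto intro!: linearI simp: linear_add linear_scale)
    then show ?thesis
      unfolding \<A>_def using S fp by (auto intro: linear_subspace_image)
  qed
  then have ne: "\<A> \<noteq> {}" by blast
  have chain: "\<Union>\<C> \<in> \<A>" if "\<C> \<noteq> {}" "subset.chain \<A> \<C>" for \<C>
  proof -
    have C: "\<And>G. G \<in> \<C> \<Longrightarrow> G \<in> \<A>" "\<And>G H. G \<in> \<C> \<Longrightarrow> H \<in> \<C> \<Longrightarrow> G \<subseteq> H \<or> H \<subseteq> G"
      using that(2) unfolding subset_chain_def by blast+
    have "subspace (\<Union>\<C>)"
      unfolding subspace_def
    proof (intro conjI ballI allI)
      show "0 \<in> \<Union>\<C>" using that(1) C(1) subspace_0 unfolding \<A>_def by blast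
    next
      fix x y assume "x \<in> \<Union>\<C>" "y \<in> \<Union>\<C>"
      then obtain G where "G \<in> \<C>" "x \<in> G" "y \<in> G" using C(2) by blast
      then show "x + y \<in> \<Union>\<C>" using C(1) unfolding \<A>_def by (blast dest: subspace_add)
    next
      fix c x assume "x \<in> \<Union>\<C>"
      then show "c *\<^sub>R x \<in> \<Union>\<C>" using C(1) unfolding \<A>_def by (blast dest: subspace_scale)
    qed
    then show ?thesis using that(1) C(1) unfolding \<A>_def by blast
  qed
  obtain M where M: "M \<in> \<A>" "\<And>X. X \<in> \<A> \<Longrightarrow> M \<subseteq> X \<Longrightarrow> X = M"
    using subset_Zorn_nonempty[OF ne chain] by blast
  have Ms: "subspace M" and MS: "\<And>x. x \<in> S \<Longrightarrow> (x, f x) \<in> M" and Mp: "\<And>x a. (x, a) \<in> M \<Longrightarrow> a \<le> p x"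
    using M(1) unfolding \<A>_def by auto
  \<comment> \<open>A vector \<open>(0, t)\<close> of \<open>M\<close> satisfies \<open>t \<le> p 0 = 0\<close>, and so does its negative.\<close>
  have uniq: "a = b" if "(x, a) \<in> M" "(x, b) \<in> M" for x a b
    using subspace_diff[OF Ms that] subspace_diff[OF Ms that(2,1)] Mp[of 0 "a - b"] Mp[of 0 "b - a"] p0
    by simp
  have total: "\<exists>a. (x0, a) \<in> M" for x0
  proof -
    have le: "a - p (x - x0) \<le> p (y + x0) - b" if "(x, a) \<in> M" "(y, b) \<in> M" for x a y b
    proof -
      have "a + b \<le> p (x + y)" using subspace_add[OF Ms that] Mp by simp
      also have "\<dots> = p ((x - x0) + (y + x0))" by simp
      also have "\<dots> \<le> p (x - x0) + p (y + x0)" by (rule sub)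
      finally show ?thesis by simp
    qed
    have z: "(0, 0) \<in> M" using subspace_0[OF Ms] by (simp add: zero_prod_def)
    \<comment> \<open>Any number between all \<open>a - p (x - x0)\<close> and all \<open>p (y + x0) - b\<close> is a possible value at \<open>x0\<close>.\<close>
    define c where "c = (SUP (x, a)\<in>M. a - p (x - x0))"
    have c1: "a - p (x - x0) \<le> c" if "(x, a) \<in> M" for x a
    proof -
      have "bdd_above ((\<lambda>(x, a). a - p (x - x0)) ` M)"
        using le[OF _ z] by (auto intro!: bdd_aboveI2[where M="p (0 + x0) - 0"])
      from cSUP_upper[OF that this] show ?thesis unfolding c_def by simp
    qed
    have c2: "c \<le> p (y + x0) - b" if "(y, b) \<in> M" for y b
      unfolding c_def by (rule cSUP_least) (use z le that in auto)
    define M' where "M' = span (insert (x0, c) M)"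
    have "b \<le> p y" if yb: "(y, b) \<in> M'" for y b
    proof -
      obtain k where k: "(y - k *\<^sub>R x0, b - k * c) \<in> M"
      proof -
        obtain k where "(y, b) - k *\<^sub>R (x0, c) \<in> span M"
          using yb unfolding M'_def span_insert by blast
        then show ?thesis using that[of k] span_eq_iff[THEN iffD2, OF Ms] by simp
      qed
      consider "k = 0" | "k > 0" | "k < 0" by linarith
      then show ?thesis
      proof cases
        case 1 then show ?thesis using k Mp by simp
      next
        case 2
        have "((1/k) *\<^sub>R (y - k *\<^sub>R x0), (1/k) * (b - k * c)) \<in> M"
          using subspace_scale[OF Ms k, of "1/k"] by simp
        from c2[OF this] have "c \<le> p ((1/k) *\<^sub>R y) - (b / k - c)"
          using 2 by (simp add: algebra_simps diff_divide_distrib)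
        then show ?thesis using 2 hom[of "1/k" y] by (simp add: field_simps)
      next
        case 3
        have "((1/-k) *\<^sub>R (y - k *\<^sub>R x0), (1/-k) * (b - k * c)) \<in> M"
          using subspace_scale[OF Ms k, of "1/-k"] by simp
        from c1[OF this] have "(c - b / k) - p ((1/-k) *\<^sub>R y) \<le> c"
          using 3 by (simp add: algebra_simps diff_divide_distrib)
        then show ?thesis using 3 hom[of "1/-k" y] by (simp add: field_simps)
      qed
    qed
    moreover have "M \<subseteq> M'" "(x0, c) \<in> M'" unfolding M'_def by (auto intro: span_base)
    moreover have "subspace M'" unfolding M'_def by simp
    ultimately have "M' \<in> \<A>" unfolding \<A>_def using MS by blast
    from M(2)[OF this \<open>M \<subseteq> M'\<close>] \<open>(x0, c) \<in> M'\<close> show ?thesis by blast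
  qed
  obtain F where F: "\<And>x. (x, F x) \<in> M" using total by metis
  have "linear F"
  proof (rule linearI)
    fix x y show "F (x + y) = F x + F y"
      using uniq[OF F] subspace_add[OF Ms F F, of x y] by simp
  next
    fix c x show "F (c *\<^sub>R x) = c *\<^sub>R F x"
      using uniq[OF F] subspace_scale[OF Ms F, of c x] by simp
  qed
  then show ?thesis using F MS Mp uniq by blast
qed

lemma norming_functional:
  fixes v :: "'a::real_normed_vector"
  assumes "v \<noteq> 0"
  shows "\<exists>\<phi>. linear \<phi> \<and> (\<forall>x. \<bar>\<phi> x\<bar> \<le> norm x) \<and> \<phi> v = norm v"
proof -
  have "independent {v}" using assms by simp
  from linear_independent_extend[OF this, of "\<lambda>_. norm v"]
  obtain f where f: "linear f" "f v = norm v" by auto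
  have "f x \<le> norm x" if x: "x \<in> span {v}" for x
  proof -
    obtain k where "x = k *\<^sub>R v" using x by (auto simp: span_singleton)
    then show ?thesis using f by (simp add: linear_scale mult_right_mono)
  qed
  then obtain F where F: "linear F" "\<forall>x\<in>span {v}. F x = f x" "\<And>x. F x \<le> norm x"
    using hahn_banach_dominated[of norm "span {v}" f] f(1) norm_triangle_ineq by auto
  have "\<bar>F x\<bar> \<le> norm x" for x
    using F(3)[of x] F(3)[of "-x"] linear_neg[OF F(1), of x] by simp
  then show ?thesis using F f(2) by (auto simp: span_base)
qed

section \<open>Coordinates on finite-dimensional subspaces\<close>

lemma bounded_linear_functionalI:
  assumes "linear \<phi>" "\<And>x. \<bar>\<phi> x\<bar> \<le> norm (x :: 'a::real_normed_vector)"
  shows "bounded_linear (\<phi> :: 'a \<Rightarrow> real)"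
  using assms by (intro bounded_linear_intro[of _ 1]) (auto simp: linear_add linear_scale)

text \<open>
  A new vector \<open>b\<close> is replaced by \<open>v = b - P b\<close>, where \<open>P\<close> is the bounded projection given by the
  coordinates found so far. A norming functional of \<open>v\<close>, composed with \<open>id - P\<close>, vanishes on the old
  span and serves as the coordinate of \<open>b\<close>. The family \<open>B\<close> may be dependent: a vector that is already
  in the span gets the coordinate zero.
\<close>

lemma bounded_coordinates:
  fixes B :: "'a::real_normed_vector set"
  assumes "finite B"
  shows "\<exists>\<theta>. (\<forall>b. bounded_linear (\<theta> b :: 'a \<Rightarrow> real)) \<and> (\<forall>x\<in>span B. (\<Sum>b\<in>B. \<theta> b x *\<^sub>R b) = x)"
  using assms
proof (induction B)
  case empty
  then show ?case by (intro exI[of _ "\<lambda>_ _. 0"]) auto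
next
  case (insert b B)
  then obtain \<theta> where \<theta>: "\<And>b. bounded_linear (\<theta> b :: 'a \<Rightarrow> real)" "\<And>x. x \<in> span B \<Longrightarrow> (\<Sum>b\<in>B. \<theta> b x *\<^sub>R b) = x"
    by blast
  define P where "P x = (\<Sum>b\<in>B. \<theta> b x *\<^sub>R b)" for x
  have P: "bounded_linear P"
    unfolding P_def by (intro bounded_linear_sum bounded_linear_scaleR_const \<theta>)
  have Pspan: "P x \<in> span B" for x unfolding P_def by (intro span_sum span_scale span_base)
  have PP: "P x = x" if "x \<in> span B" for x using \<theta>(2)[OF that] unfolding P_def .
  define v where "v = b - P b"
  show ?case
  proof (cases "v = 0")
    case True
    then have "b \<in> span B" using Pspan[of b] unfolding v_def by simp
    then have sp: "span (insert b B) = span B" by (simp add: span_redundant)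
    show ?thesis
      unfolding sp
    proof (intro exI[of _ "\<lambda>c. if c = b then (\<lambda>_. 0) else \<theta> c"] conjI allI ballI)
      fix x assume "x \<in> span B"
      have "(\<Sum>c\<in>B. (if c = b then (\<lambda>_. 0) else \<theta> c) x *\<^sub>R c) = (\<Sum>c\<in>B. \<theta> c x *\<^sub>R c)"
        using insert.hyps by (intro sum.cong) auto
      then show "(\<Sum>c\<in>insert b B. (if c = b then (\<lambda>_. 0) else \<theta> c) x *\<^sub>R c) = x"
        using insert.hyps \<theta>(2)[OF \<open>x \<in> span B\<close>] by simp
    qed (simp add: \<theta>(1))
  next
    case False
    from norming_functional[OF this]
    obtain \<phi> where \<phi>: "linear \<phi>" "\<And>x. \<bar>\<phi> x\<bar> \<le> norm x" "\<phi> v = norm v" by blast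
    have bl: "bounded_linear \<phi>" by (rule bounded_linear_functionalI) fact+
    define \<psi> where "\<psi> x = \<phi> (x - P x) / norm v" for x
    have \<psi>: "bounded_linear \<psi>"
      unfolding \<psi>_def
      by (intro bounded_linear_divide bounded_linear_compose[OF bl] bounded_linear_sub bounded_linear_ident P
            bounded_linear_compose[OF bounded_linear_divide])
    have \<psi>B: "\<psi> x = 0" if "x \<in> span B" for x
      using PP[OF that] linear_0[OF \<phi>(1)] unfolding \<psi>_def by simp
    have \<psi>b: "\<psi> b = 1" using \<phi>(3) False unfolding \<psi>_def v_def by simp
    define \<theta>' where "\<theta>' c = (if c = b then \<psi> else (\<lambda>x. \<theta> c x - \<psi> x * \<theta> c b))" for c
    have eq: "(\<Sum>c\<in>insert b B. \<theta>' c x *\<^sub>R c) = P x + \<psi> x *\<^sub>R v" for x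
    proof -
      have "(\<Sum>c\<in>insert b B. \<theta>' c x *\<^sub>R c) = \<psi> x *\<^sub>R b + (\<Sum>c\<in>B. \<theta>' c x *\<^sub>R c)"
        using insert.hyps by (simp add: \<theta>'_def)
      also have "(\<Sum>c\<in>B. \<theta>' c x *\<^sub>R c) = (\<Sum>c\<in>B. \<theta> c x *\<^sub>R c - \<psi> x *\<^sub>R (\<theta> c b *\<^sub>R c))"
        using insert.hyps by (intro sum.cong) (auto simp: \<theta>'_def algebra_simps)
      also have "\<dots> = P x - \<psi> x *\<^sub>R P b"
        unfolding P_def by (simp add: sum_subtractf scaleR_sum_right)
      finally show ?thesis unfolding v_def by (simp add: algebra_simps)
    qed
    have "P x + \<psi> x *\<^sub>R v = x" if x: "x \<in> span (insert b B)" for x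
    proof -
      obtain k where k: "x - k *\<^sub>R b \<in> span B" using x unfolding span_insert by blast
      define y where "y = x - k *\<^sub>R b"
      have x: "x = y + k *\<^sub>R b" unfolding y_def by simp
      have y: "P y = y" "\<psi> y = 0" using k PP \<psi>B unfolding y_def by auto
      have "P x = y + k *\<^sub>R P b" "\<psi> x = k"
        unfolding x using y \<psi>b P \<psi>
        by (auto simp: linear_add linear_scale bounded_linear.linear)
      then show ?thesis unfolding x v_def by (simp add: algebra_simps)
    qed
    moreover have "bounded_linear (\<theta>' c)" for c
      unfolding \<theta>'_def using \<theta>(1) \<psi>
      by (auto intro!: bounded_linear_sub bounded_linear_compose[OF bounded_linear_mult_left])
    ultimately show ?thesis using eq by (intro exI[of _ \<theta>']) auto
  qed
qed

lemma bounded_coordinates_uniform: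
  fixes B :: "'a::real_normed_vector set"
  assumes "finite B"
  shows "\<exists>\<theta> M. M \<ge> 0 \<and> (\<forall>b. bounded_linear (\<theta> b :: 'a \<Rightarrow> real)) \<and> (\<forall>b\<in>B. \<forall>x. \<bar>\<theta> b x\<bar> \<le> M * norm x) \<and>
           (\<forall>x\<in>span B. (\<Sum>b\<in>B. \<theta> b x *\<^sub>R b) = x)"
proof -
  obtain \<theta> where \<theta>: "\<And>b. bounded_linear (\<theta> b :: 'a \<Rightarrow> real)" "\<And>x. x \<in> span B \<Longrightarrow> (\<Sum>b\<in>B. \<theta> b x *\<^sub>R b) = x"
    using bounded_coordinates[OF assms] by blast
  define M where "M = (\<Sum>b\<in>B. onorm (\<theta> b))"
  have "\<bar>\<theta> b x\<bar> \<le> M * norm x" if "b \<in> B" for b x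
  proof -
    have "\<bar>\<theta> b x\<bar> \<le> onorm (\<theta> b) * norm x" using onorm[OF \<theta>(1)[of b], of x] by simp
    also have "onorm (\<theta> b) \<le> M" unfolding M_def using assms that \<theta>(1)
      by (intro member_le_sum) (auto intro: onorm_pos_le)
    finally show ?thesis by (simp add: mult_right_mono)
  qed
  moreover have "M \<ge> 0" unfolding M_def using \<theta>(1) by (intro sum_nonneg onorm_pos_le)
  ultimately show ?thesis using \<theta> by blast
qed

section \<open>Packing in finite-dimensional balls\<close>

definition separated :: "real \<Rightarrow> 'a::real_normed_vector set \<Rightarrow> bool" where
  "separated d S \<longleftrightarrow> (\<forall>x\<in>S. \<forall>y\<in>S. x \<noteq> y \<longrightarrow> d \<le> norm (x - y))"

text \<open>
  Rounding coordinates to a grid of mesh \<open>\<mu>\<close> separates the points of a \<open>d\<close>-separated set. The constant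
  \<open>c\<close> may be very bad; only the exponent \<open>card B\<close> matters for the sharp bound below.
\<close>

lemma separated_card_polynomial:
  fixes B :: "'a::real_normed_vector set"
  assumes B: "finite B" and d: "d > 0"
  shows "\<exists>c\<ge>0. \<forall>S R. 1 \<le> R \<longrightarrow> S \<subseteq> span B \<longrightarrow> S \<subseteq> cball 0 R \<longrightarrow> separated d S \<longrightarrow>
            finite S \<and> real (card S) \<le> (c * R) ^ card B"
proof -
  obtain \<theta> M where M: "M \<ge> 0" "\<And>b x. b \<in> B \<Longrightarrow> \<bar>\<theta> b x\<bar> \<le> M * norm x"
    and \<theta>: "\<And>b. bounded_linear (\<theta> b :: 'a \<Rightarrow> real)" "\<And>x. x \<in> span B \<Longrightarrow> (\<Sum>b\<in>B. \<theta> b x *\<^sub>R b) = x"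
    using bounded_coordinates_uniform[OF B] by metis
  define \<mu> where "\<mu> = d / (2 * ((\<Sum>b\<in>B. norm b) + 1))"
  have nn: "(\<Sum>b\<in>B. norm b) \<ge> 0" by (simp add: sum_nonneg)
  then have \<mu>: "\<mu> > 0" using d unfolding \<mu>_def by simp
  define c where "c = 2 * (M / \<mu> + 1) + 1"
  have c0: "c \<ge> 0" using M \<mu> unfolding c_def by simp
  have "finite S \<and> real (card S) \<le> (c * R) ^ card B"
    if R: "1 \<le> R" and S: "S \<subseteq> span B" "S \<subseteq> cball 0 R" "separated d S" for S R
  proof -
    define k where "k = \<lfloor>M * R / \<mu>\<rfloor> + 1"
    define r where "r x = (\<lambda>b\<in>B. \<lfloor>\<theta> b x / \<mu>\<rfloor>)" for x
    have inj: "inj_on r S"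
    proof (rule inj_onI, rule ccontr)
      fix x y assume xy: "x \<in> S" "y \<in> S" "r x = r y" "x \<noteq> y"
      have "\<bar>\<theta> b (x - y)\<bar> \<le> \<mu>" if "b \<in> B" for b
      proof -
        have "\<lfloor>\<theta> b x / \<mu>\<rfloor> = \<lfloor>\<theta> b y / \<mu>\<rfloor>"
          using fun_cong[OF xy(3), of b] that unfolding r_def by simp
        then have "\<bar>\<theta> b x / \<mu> - \<theta> b y / \<mu>\<bar> \<le> 1" by linarith
        then show ?thesis using \<mu> linear_diff[OF bounded_linear.linear[OF \<theta>(1)], of b x y]
          by (simp add: field_simps flip: diff_divide_distrib)
      qed
      moreover have "x - y \<in> span B" using S(1) xy by (auto intro: span_diff)
      ultimately have "norm (x - y) = norm (\<Sum>b\<in>B. \<theta> b (x - y) *\<^sub>R b)" "\<forall>b\<in>B. \<bar>\<theta> b (x - y)\<bar> \<le> \<mu>"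
        using \<theta>(2) by auto
      then have "norm (x - y) \<le> (\<Sum>b\<in>B. \<mu> * norm b)"
        using sum_norm_le[of B "\<lambda>b. \<theta> b (x - y) *\<^sub>R b" "\<lambda>b. \<mu> * norm b"] by (simp add: mult_right_mono)
      also have "\<dots> = \<mu> * (\<Sum>b\<in>B. norm b)" by (simp only: sum_distrib_left)
      also have "\<dots> < \<mu> * (2 * ((\<Sum>b\<in>B. norm b) + 1))" using nn \<mu> by simp
      also have "\<dots> = d" using nn unfolding \<mu>_def by simp
      finally show False using S(3) xy unfolding separated_def by force
    qed
    have ran: "r ` S \<subseteq> (\<Pi>\<^sub>E b\<in>B. {-k..k})"
    proof
      fix z assume "z \<in> r ` S"
      then obtain x where x: "x \<in> S" "z = r x" by blast
      have "\<lfloor>\<theta> b x / \<mu>\<rfloor> \<in> {-k..k}" if "b \<in> B" for b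
      proof -
        have "\<bar>\<theta> b x\<bar> \<le> M * R"
          using M(2)[OF that, of x] S(2) x(1) M(1) by (force intro: order_trans mult_left_mono)
        then have "\<bar>\<theta> b x / \<mu>\<bar> \<le> M * R / \<mu>" using \<mu> by (simp add: divide_right_mono)
        then have "- (M * R / \<mu>) \<le> \<theta> b x / \<mu>" "\<theta> b x / \<mu> \<le> M * R / \<mu>"
          by (simp_all only: abs_le_iff) linarith
        then show ?thesis unfolding k_def atLeastAtMost_iff by linarith
      qed
      then show "z \<in> (\<Pi>\<^sub>E b\<in>B. {-k..k})" unfolding x(2) r_def by auto
    qed
    have fin: "finite (\<Pi>\<^sub>E b\<in>B. {-k..k})" using B by (intro finite_PiE) auto
    have "card S \<le> card (\<Pi>\<^sub>E b\<in>B. {-k..k})"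
      using card_inj_on_le[OF inj ran fin] .
    also have "\<dots> = nat (2 * k + 1) ^ card B" using B by (simp add: card_PiE)
    finally have "real (card S) \<le> real (nat (2 * k + 1)) ^ card B"
      by (metis of_nat_le_iff of_nat_power)
    also have "\<dots> \<le> (c * R) ^ card B"
    proof (rule power_mono)
      have "k \<ge> 0" unfolding k_def using M R \<mu> by simp
      then have "real (nat (2 * k + 1)) = 2 * real_of_int k + 1" by simp
      also have "\<dots> \<le> 2 * (M * R / \<mu> + 1) + 1"
        unfolding k_def using of_int_floor_le[of "M * R / \<mu>"] by (simp del: of_int_floor_le)
      also have "\<dots> \<le> c * R" unfolding c_def using R by (simp add: field_simps)
      finally show "real (nat (2 * k + 1)) \<le> c * R" .
    qed simp
    finally show ?thesis using inj_on_finite[OF inj ran fin] by blast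
  qed
  then show ?thesis using c0 by blast
qed

text \<open>
  The volumetric bound, without volumes. If \<open>A\<close> is \<open>d\<close>-separated in the unit ball and \<open>\<alpha> = 1 + 2/d\<close>,
  then the sums \<open>\<Sum>\<^bsub>j<J\<^esub> \<alpha>\<^sup>j a\<^sub>j\<close> with \<open>a\<^sub>j \<in> A\<close> are again \<open>d\<close>-separated, hence there are \<open>(card A)\<^sup>J\<close> of them in
  a ball of radius proportional to \<open>\<alpha>\<^sup>J\<close>. The crude polynomial bound gives
  \<open>(card A)\<^sup>J \<le> C (\<alpha>\<^sup>n)\<^sup>J\<close> with \<open>n = card B\<close> for all \<open>J\<close>, and the constant \<open>C\<close> disappears as \<open>J\<close> grows.
\<close>

lemma packing_bound:
  fixes B A :: "'a::real_normed_vector set"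
  assumes B: "finite B" and d: "d > 0"
    and A: "A \<subseteq> span B" "A \<subseteq> cball 0 1" "separated d A"
  shows "finite A \<and> real (card A) \<le> (1 + 2 / d) ^ card B"
proof -
  obtain c where c: "c \<ge> 0" "\<And>S R. 1 \<le> R \<Longrightarrow> S \<subseteq> span B \<Longrightarrow> S \<subseteq> cball 0 R \<Longrightarrow> separated d S \<Longrightarrow>
            finite S \<and> real (card S) \<le> (c * R) ^ card B"
    using separated_card_polynomial[OF B d] by blast
  have finA: "finite A" using c(2)[of 1] A by simp
  define \<alpha> where "\<alpha> = 1 + 2 / d"
  have \<alpha>: "\<alpha> > 1" "\<alpha> * d = d + 2" using d unfolding \<alpha>_def by (auto simp: field_simps)
  have step: "\<exists>S. finite S \<and> card S = card A ^ J \<and> S \<subseteq> span B \<and> S \<subseteq> cball 0 (d * \<alpha> ^ J) \<and> separated d S" for J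
  proof -
    have "\<exists>S. finite S \<and> card S = card A ^ J \<and> S \<subseteq> span B \<and> S \<subseteq> cball 0 (d * (\<alpha> ^ J - 1) / 2) \<and> separated d S"
    proof (induction J)
      case 0
      show ?case by (intro exI[of _ "{0}"]) (auto simp: separated_def span_zero)
    next
      case (Suc J)
      then obtain S where S: "finite S" "card S = card A ^ J" "S \<subseteq> span B" "S \<subseteq> cball 0 (d * (\<alpha> ^ J - 1) / 2)" "separated d S"
        by blast
      \<comment> \<open>Scaling by \<open>\<alpha>\<close> turns the separation \<open>d\<close> of \<open>S\<close> into \<open>d + 2\<close>, which leaves room for
        two translations by points of the unit ball.\<close>
      define F where "F = (\<lambda>(s, a). \<alpha> *\<^sub>R s + a :: 'a)"
      have sep: "d \<le> norm (F p - F q)" if pq: "p \<in> S \<times> A" "q \<in> S \<times> A" "p \<noteq> q" for p q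
      proof -
        obtain s a t b where p: "p = (s, a)" and q: "q = (t, b)" by fastforce
        show ?thesis
        proof (cases "s = t")
          case True
          then show ?thesis using A(3) pq unfolding p q F_def separated_def by auto
        next
          case False
          have "a \<in> cball 0 1" "b \<in> cball 0 1" using A(2) pq(1,2) unfolding p q by auto
          then have "norm (a - b) \<le> 2"
            using norm_triangle_ineq4[of a b] by simp
          moreover have "\<alpha> * d \<le> norm (\<alpha> *\<^sub>R (s - t))"
            using S(5) False pq(1,2) \<alpha>(1) unfolding p q separated_def by (auto intro: mult_left_mono)
          moreover have "norm (\<alpha> *\<^sub>R (s - t)) - norm (a - b) \<le> norm (F p - F q)"
            using norm_diff_ineq[of "\<alpha> *\<^sub>R (s - t)" "a - b"] unfolding p q F_def by (simp add: algebra_simps)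
          ultimately show ?thesis using \<alpha>(2) by linarith
        qed
      qed
      have "inj_on F (S \<times> A)"
        using sep d by (intro inj_onI) force
      then have "card (F ` (S \<times> A)) = card A ^ Suc J"
        using S(2) by (simp add: card_image card_cartesian_product)
      moreover have "F ` (S \<times> A) \<subseteq> span B"
        using S(3) A(1) unfolding F_def by (fastforce intro: span_add span_scale)
      moreover have "F ` (S \<times> A) \<subseteq> cball 0 (d * (\<alpha> ^ Suc J - 1) / 2)"
      proof
        fix z assume "z \<in> F ` (S \<times> A)"
        then obtain s a where z: "z = F (s, a)" and "s \<in> S" "a \<in> A" by auto
        then have "norm s \<le> d * (\<alpha> ^ J - 1) / 2" "norm a \<le> 1" using S(4) A(2) by (auto simp: subset_iff)
        then have "norm (\<alpha> *\<^sub>R s + a) \<le> \<alpha> * (d * (\<alpha> ^ J - 1) / 2) + 1"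
          using \<alpha> by (intro norm_triangle_le) (auto intro!: add_mono mult_left_mono)
        also have "\<dots> = ((\<alpha> * d) * \<alpha> ^ J - \<alpha> * d + 2) / 2" by (simp add: field_simps)
        also have "\<dots> = (\<alpha> * d * \<alpha> ^ J - d) / 2" using \<alpha>(2) by simp
        also have "\<dots> = d * (\<alpha> * \<alpha> ^ J - 1) / 2" by (simp add: field_simps)
        finally show "z \<in> cball 0 (d * (\<alpha> ^ Suc J - 1) / 2)" unfolding z F_def by simp
      qed
      moreover have "separated d (F ` (S \<times> A))"
        using sep unfolding separated_def by fastforce
      moreover have "finite (F ` (S \<times> A))" using S(1) finA by simp
      ultimately show ?case by blast
    qed
    moreover have "d * (\<alpha> ^ J - 1) / 2 \<le> d * \<alpha> ^ J" using d \<alpha>(1) by (simp add: field_simps)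
    ultimately show ?thesis by (meson order_trans subset_cball)
  qed
  define n where "n = card B"
  define C where "C = (c * (d + 1)) ^ n"
  have bound: "real (card A) ^ J \<le> C * (\<alpha> ^ n) ^ J" for J
  proof -
    have a1: "1 \<le> \<alpha> ^ J" using \<alpha>(1) by simp
    obtain S where S: "finite S" "card S = card A ^ J" "S \<subseteq> span B" "S \<subseteq> cball 0 (d * \<alpha> ^ J)" "separated d S"
      using step by blast
    have "1 \<le> (d + 1) * \<alpha> ^ J" "d * \<alpha> ^ J \<le> (d + 1) * \<alpha> ^ J"
      using a1 d
      using mult_mono[of 1 "d + 1" 1 "\<alpha> ^ J"] mult_right_mono[of d "d + 1" "\<alpha> ^ J"] by auto
    then have "real (card S) \<le> (c * ((d + 1) * \<alpha> ^ J)) ^ n"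
      using c(2)[of "(d + 1) * \<alpha> ^ J" S] S(3-5) unfolding n_def by (meson order_trans subset_cball)
    also have "\<dots> = C * (\<alpha> ^ n) ^ J"
    proof -
      have "(\<alpha> ^ J) ^ n = (\<alpha> ^ n) ^ J" by (metis power_mult mult.commute)
      then show ?thesis unfolding C_def by (simp add: power_mult_distrib)
    qed
    finally show ?thesis using S(2) by simp
  qed
  have "real (card A) \<le> \<alpha> ^ n"
  proof (rule ccontr)
    assume "\<not> ?thesis"
    then have q: "1 < real (card A) / \<alpha> ^ n" using \<alpha>(1) by (simp add: field_simps)
    obtain J where "C < (real (card A) / \<alpha> ^ n) ^ J" using real_arch_pow[OF q] by blast
    then have "C * (\<alpha> ^ n) ^ J < real (card A) ^ J"
      using \<alpha>(1) by (simp add: power_divide field_simps)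
    then show False using bound[of J] by linarith
  qed
  then show ?thesis using finA unfolding \<alpha>_def n_def by simp
qed

text \<open>
  A separated subset of maximal cardinality is a net.
\<close>

lemma finite_net:
  fixes B S :: "'a::real_normed_vector set"
  assumes B: "finite B" and d: "d > 0" and S: "S \<subseteq> span B" "S \<subseteq> cball 0 1"
  shows "\<exists>A\<subseteq>S. finite A \<and> real (card A) \<le> (1 + 2 / d) ^ card B \<and> (\<forall>x\<in>S. \<exists>a\<in>A. norm (x - a) < d)"
proof -
  define P where "P A \<longleftrightarrow> A \<subseteq> S \<and> separated d A" for A
  have PB: "finite A \<and> real (card A) \<le> (1 + 2 / d) ^ card B" if "P A" for A
    using packing_bound[OF B d] that S unfolding P_def by blast
  have "P {}" unfolding P_def separated_def by simp
  moreover have "card A < nat \<lceil>(1 + 2 / d) ^ card B\<rceil> + 1" if "P A" for A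
  proof -
    have "real (card A) \<le> of_int \<lceil>(1 + 2 / d) ^ card B\<rceil>"
      using PB[OF that] le_of_int_ceiling order_trans by blast
    then show ?thesis by linarith
  qed
  ultimately have "\<exists>A. P A \<and> (\<forall>A'. P A' \<longrightarrow> card A' \<le> card A)"
    by (intro ex_has_greatest_nat[of P "{}"]) auto
  then obtain A where A: "P A" "\<And>A'. P A' \<Longrightarrow> card A' \<le> card A"
    by blast
  have "\<exists>a\<in>A. norm (x - a) < d" if x: "x \<in> S" for x
  proof (rule ccontr)
    assume no: "\<not> ?thesis"
    then have "x \<notin> A" using d by force
    moreover have "P (insert x A)"
      using A(1) x no unfolding P_def separated_def by (auto simp: not_less norm_minus_commute)
    ultimately show False using A(2)[of "insert x A"] PB[OF A(1)] by simp
  qed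
  then show ?thesis using A(1) PB[OF A(1)] unfolding P_def by blast
qed

section \<open>Averaging along segments\<close>

definition avg :: "'a \<Rightarrow> real \<Rightarrow> ('a::real_normed_vector \<Rightarrow> 'b::banach) \<Rightarrow> 'a \<Rightarrow> 'b" where
  "avg v l g y = (1 / (2 * l)) *\<^sub>R integral {-l..l} (\<lambda>a. g (y + a *\<^sub>R v))"

definition diffquot :: "'a \<Rightarrow> real \<Rightarrow> ('a::real_normed_vector \<Rightarrow> 'b::banach) \<Rightarrow> 'a \<Rightarrow> 'b" where
  "diffquot v l g y = (1 / (2 * l)) *\<^sub>R (g (y + l *\<^sub>R v) - g (y - l *\<^sub>R v))"

text \<open>
  Directional differentiability is required at every point and with continuous derivative. Without
  continuity, the derivatives in two directions need not add up.
\<close>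

definition C1_along :: "('a::real_normed_vector \<Rightarrow> 'b::banach) \<Rightarrow> 'a \<Rightarrow> ('a \<Rightarrow> 'b) \<Rightarrow> bool" where
  "C1_along g u D \<longleftrightarrow> continuous_on UNIV D \<and>
     (\<forall>y. ((\<lambda>t. g (y + t *\<^sub>R u)) has_vector_derivative D y) (at 0))"

lemma continuous_on_line:
  fixes g :: "'a::real_normed_vector \<Rightarrow> 'b::topological_space"
  shows "continuous_on UNIV g \<Longrightarrow> continuous_on S (\<lambda>a::real. g (y + a *\<^sub>R v))"
  by (rule continuous_on_compose2[of UNIV g]) (auto intro!: continuous_intros)

lemma integrable_on_line:
  fixes g :: "'a::real_normed_vector \<Rightarrow> 'b::banach"
  shows "continuous_on UNIV g \<Longrightarrow> (\<lambda>a::real. g (y + a *\<^sub>R v)) integrable_on {a..b}"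
  by (intro integrable_continuous_interval continuous_on_line)

lemma continuous_avg:
  assumes "continuous_on UNIV g"
  shows "continuous_on UNIV (avg v l g)"
proof -
  have "continuous_on (UNIV \<times> cbox (-l) l) (\<lambda>(y, a). g (y + a *\<^sub>R v))"
    unfolding split_def
    by (rule continuous_on_compose2[OF assms]) (auto intro!: continuous_intros)
  from integral_continuous_on_param[OF this] show ?thesis
    unfolding avg_def by (auto intro!: continuous_intros)
qed

lemma continuous_diffquot:
  assumes "continuous_on UNIV g"
  shows "continuous_on UNIV (diffquot v l g)"
  unfolding diffquot_def
  by (intro continuous_intros continuous_on_compose2[OF assms]) auto

lemma norm_avg_diff_le:
  assumes l: "l > 0" and g: "continuous_on UNIV g"
    and b: "\<And>a. \<bar>a\<bar> \<le> l \<Longrightarrow> norm (g (y + a *\<^sub>R v) - c) \<le> \<eta>"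
  shows "norm (avg v l g y - c) \<le> \<eta>"
proof -
  have "integral {-l..l} (\<lambda>a. g (y + a *\<^sub>R v) - c) = integral {-l..l} (\<lambda>a. g (y + a *\<^sub>R v)) - (2 * l) *\<^sub>R c"
    using l by (subst integral_diff) (auto intro: integrable_on_line g)
  then have "avg v l g y - c = (1 / (2 * l)) *\<^sub>R integral {-l..l} (\<lambda>a. g (y + a *\<^sub>R v) - c)"
    using l unfolding avg_def by (simp add: scaleR_diff_right)
  moreover have "norm (integral {-l..l} (\<lambda>a. g (y + a *\<^sub>R v) - c)) \<le> \<eta> * (l - - l)"
    using l b by (intro integral_bound continuous_intros continuous_on_line g) auto
  ultimately show ?thesis using l by (simp add: field_simps)
qed

text \<open>
  Averaging along \<open>v\<close> makes any continuous function differentiable along \<open>v\<close>, by the fundamental theorem of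
  calculus; the derivative is the difference quotient over the whole segment.
\<close>

lemma C1_along_avg_same:
  assumes l: "l > 0" and g: "continuous_on UNIV g"
  shows "C1_along (avg v l g) v (diffquot v l g)"
  unfolding C1_along_def
proof (intro conjI allI continuous_diffquot g)
  fix y
  define h where "h a = g (y + a *\<^sub>R v)" for a
  define H where "H x = integral {-l - 2..x} h" for x
  have ch: "continuous_on S h" for S unfolding h_def by (rule continuous_on_line[OF g])
  have H: "(H has_vector_derivative h x) (at x)" if "\<bar>x\<bar> < l + 1" for x
  proof -
    have "(H has_vector_derivative h x) (at x within {-l - 2..l + 2})"
      unfolding H_def using that by (intro integral_has_vector_derivative ch) auto
    then have "(H has_vector_derivative h x) (at x within {-l - 2<..<l + 2})"
      by (rule has_vector_derivative_within_subset) auto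
    then show ?thesis using that by (subst (asm) has_vector_derivative_within_open) auto
  qed
  have eq: "avg v l g (y + t *\<^sub>R v) = (1 / (2 * l)) *\<^sub>R (H (l + t) - H (- l + t))" if t: "t \<in> {-1<..<1}" for t
  proof -
    have "((\<lambda>a. h (a + t)) has_integral H (l + t) - H (- l + t)) {-l..l}"
    proof (rule fundamental_theorem_of_calculus)
      fix x assume x: "x \<in> {-l..l}"
      have "(H has_vector_derivative h (x + t)) (at (x + t))" using H x t by auto
      moreover have "((\<lambda>a. a + t) has_vector_derivative 1) (at x)" by (auto intro!: derivative_eq_intros)
      ultimately have "((\<lambda>a. H (a + t)) has_vector_derivative h (x + t)) (at x)"
        using vector_diff_chain_at[of "\<lambda>a. a + t" 1 x H] by (simp add: o_def)
      then show "((\<lambda>a. H (a + t)) has_vector_derivative h (x + t)) (at x within {-l..l})"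
        by (rule has_vector_derivative_at_within)
    qed (use l in auto)
    then have "integral {-l..l} (\<lambda>a. h (a + t)) = H (l + t) - H (- l + t)" by (rule integral_unique)
    moreover have "(\<lambda>a. g (y + t *\<^sub>R v + a *\<^sub>R v)) = (\<lambda>a. h (a + t))"
      unfolding h_def by (simp add: algebra_simps)
    ultimately show ?thesis unfolding avg_def by simp
  qed
  have "((\<lambda>t. (1 / (2 * l)) *\<^sub>R (H (l + t) - H (- l + t))) has_vector_derivative
          (1 / (2 * l)) *\<^sub>R (h l - h (- l))) (at 0)"
  proof -
    have "((\<lambda>t. H (x + t)) has_vector_derivative h x) (at 0)" if "\<bar>x\<bar> = l" for x
    proof -
      have "((+) x has_vector_derivative 1) (at 0)" by (auto intro!: derivative_eq_intros)
      then show ?thesis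
        using vector_diff_chain_at[of "(+) x" 1 0 H "h x"] H[of x] that by (simp add: o_def)
    qed
    from this[of l] this[of "-l"] l show ?thesis
      by (auto intro!: derivative_eq_intros)
  qed
  then have "((\<lambda>t. avg v l g (y + t *\<^sub>R v)) has_vector_derivative (1 / (2 * l)) *\<^sub>R (h l - h (- l))) (at 0)"
    by (rule has_vector_derivative_transform_within_open[where S="{-1<..<1}"]) (auto simp: eq)
  then show "((\<lambda>t. avg v l g (y + t *\<^sub>R v)) has_vector_derivative diffquot v l g y) (at 0)"
    unfolding diffquot_def h_def by simp
qed

lemma C1_along_at:
  assumes "C1_along g u D"
  shows "((\<lambda>t. g (y + t *\<^sub>R u)) has_vector_derivative D (y + t *\<^sub>R u)) (at t)"
proof -
  have "((\<lambda>s. g (y + t *\<^sub>R u + s *\<^sub>R u)) has_vector_derivative D (y + t *\<^sub>R u)) (at (t - t))"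
    using assms unfolding C1_along_def by simp
  then have "((\<lambda>s. g (y + t *\<^sub>R u + s *\<^sub>R u)) \<circ> (\<lambda>s. s - t) has_vector_derivative 1 *\<^sub>R D (y + t *\<^sub>R u)) (at t)"
    by (intro vector_diff_chain_at) (auto intro!: derivative_eq_intros)
  then show ?thesis by (simp add: o_def algebra_simps)
qed

lemma C1_along_avg:
  assumes g: "continuous_on UNIV g" and D: "C1_along g u D"
  shows "C1_along (avg v l g) u (avg v l D)"
  unfolding C1_along_def
proof (intro conjI allI)
  have cD: "continuous_on UNIV D" using D unfolding C1_along_def by blast
  then show "continuous_on UNIV (avg v l D)" by (rule continuous_avg)
  fix y
  have "((\<lambda>t. integral (cbox (-l) l) (\<lambda>a. g (y + a *\<^sub>R v + t *\<^sub>R u))) has_vector_derivative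
          integral (cbox (-l) l) (\<lambda>a. D (y + a *\<^sub>R v + 0 *\<^sub>R u))) (at 0 within UNIV)"
  proof (rule leibniz_rule_vector_derivative[where U=UNIV and fx="\<lambda>t a. D (y + a *\<^sub>R v + t *\<^sub>R u)"])
    show "((\<lambda>t. g (y + a *\<^sub>R v + t *\<^sub>R u)) has_vector_derivative D (y + a *\<^sub>R v + t *\<^sub>R u)) (at t within UNIV)" for t a
      using C1_along_at[OF D] by simp
    show "(\<lambda>a. g (y + a *\<^sub>R v + t *\<^sub>R u)) integrable_on cbox (-l) l" for t
      using integrable_on_line[OF g, of "y + t *\<^sub>R u" v "-l" l] by (simp add: algebra_simps)
    show "continuous_on (UNIV \<times> cbox (-l) l) (\<lambda>(t, a). D (y + a *\<^sub>R v + t *\<^sub>R u))"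
      unfolding split_def by (rule continuous_on_compose2[OF cD]) (auto intro!: continuous_intros)
  qed auto
  then have "((\<lambda>t. (1 / (2 * l)) *\<^sub>R integral {-l..l} (\<lambda>a. g (y + a *\<^sub>R v + t *\<^sub>R u))) has_vector_derivative avg v l D y) (at 0)"
    unfolding avg_def by (auto intro!: derivative_eq_intros)
  moreover have "(\<lambda>t. avg v l g (y + t *\<^sub>R u)) = (\<lambda>t. (1 / (2 * l)) *\<^sub>R integral {-l..l} (\<lambda>a. g (y + a *\<^sub>R v + t *\<^sub>R u)))"
    unfolding avg_def by (simp add: algebra_simps)
  ultimately show "((\<lambda>t. avg v l g (y + t *\<^sub>R u)) has_vector_derivative avg v l D y) (at 0)" by simp
qed

lemma C1_along_unique:
  assumes "C1_along g u D" "C1_along g u E" shows "D = E"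
  using assms unfolding C1_along_def by (metis vector_derivative_unique_at ext)

lemma C1_along_zero: "C1_along g 0 (\<lambda>_. 0)"
  unfolding C1_along_def by auto

lemma C1_along_scale:
  assumes "C1_along g u D"
  shows "C1_along g (c *\<^sub>R u) (\<lambda>y. c *\<^sub>R D y)"
  unfolding C1_along_def
proof (intro conjI allI)
  show "continuous_on UNIV (\<lambda>y. c *\<^sub>R D y)" using assms unfolding C1_along_def by (auto intro!: continuous_intros)
  fix y
  have "((\<lambda>t. g (y + t *\<^sub>R u)) \<circ> (\<lambda>t. c * t) has_vector_derivative c *\<^sub>R D y) (at 0)"
    using assms unfolding C1_along_def by (intro vector_diff_chain_at) (auto intro!: derivative_eq_intros)
  then show "((\<lambda>t. g (y + t *\<^sub>R c *\<^sub>R u)) has_vector_derivative c *\<^sub>R D y) (at 0)"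
    by (simp add: o_def mult.commute)
qed

text \<open>
  Restrict \<open>g\<close> to the plane through \<open>y\<close> in the directions \<open>u\<close> and \<open>v\<close>. Its partial derivatives are
  continuous, so it is differentiable there, and the diagonal direction is \<open>u + v\<close>.
\<close>

lemma C1_along_add:
  assumes u: "C1_along g u D" and v: "C1_along g v E"
  shows "C1_along g (u + v) (\<lambda>y. D y + E y)"
  unfolding C1_along_def
proof (intro conjI allI)
  have cD: "continuous_on UNIV D" and cE: "continuous_on UNIV E" using u v unfolding C1_along_def by auto
  then show "continuous_on UNIV (\<lambda>y. D y + E y)" by (intro continuous_intros)
  fix y
  define f where "f s t = g (y + s *\<^sub>R u + t *\<^sub>R v)" for s t :: real
  define Ef where "Ef s t = blinfun_scaleR_left (E (y + s *\<^sub>R u + t *\<^sub>R v))" for s t :: real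
  have "((\<lambda>(s, t). f s t) has_derivative (\<lambda>(a, b). a *\<^sub>R D y + blinfun_apply (Ef 0 0) b)) (at (0, 0) within UNIV \<times> UNIV)"
  proof (rule has_derivative_partialsI[where f=f and fy=Ef and fx="\<lambda>a. a *\<^sub>R D y"])
    show "((\<lambda>s. f s 0) has_derivative (\<lambda>a. a *\<^sub>R D y)) (at 0 within UNIV)"
      using C1_along_at[OF u, of y 0] unfolding f_def has_vector_derivative_def by simp
    show "((\<lambda>t. f s t) has_derivative blinfun_apply (Ef s t)) (at t within UNIV)" for s t
      using C1_along_at[OF v, of "y + s *\<^sub>R u" t] unfolding f_def Ef_def has_vector_derivative_def
      by (simp add: blinfun_scaleR_left.rep_eq)
    have "continuous_on UNIV (\<lambda>p. Ef (fst p) (snd p))"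
      unfolding Ef_def
      by (intro bounded_linear.continuous_on[OF bounded_linear_blinfun_scaleR_left] continuous_on_compose2[OF cE])
         (auto intro!: continuous_intros)
    then show "continuous (at (0, 0) within UNIV \<times> UNIV) (\<lambda>(s, t). Ef s t)"
      by (simp add: continuous_on_eq_continuous_within split_def)
  qed auto
  then have "((\<lambda>p. f (fst p) (snd p)) has_derivative (\<lambda>p. fst p *\<^sub>R D y + snd p *\<^sub>R E y)) (at (0, 0))"
    unfolding Ef_def by (simp add: split_def blinfun_scaleR_left.rep_eq)
  moreover have "((\<lambda>t. (t, t)) has_derivative (\<lambda>t. (t, t))) (at (0::real))"
    by (intro derivative_intros)
  ultimately have "((\<lambda>t. f t t) has_derivative (\<lambda>t. t *\<^sub>R D y + t *\<^sub>R E y)) (at 0)"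
    using has_derivative_compose[of "\<lambda>t. (t, t)" "\<lambda>t. (t, t)" 0 UNIV] by fastforce
  then show "((\<lambda>t. g (y + t *\<^sub>R (u + v))) has_vector_derivative D y + E y) (at 0)"
    unfolding has_vector_derivative_def f_def by (simp add: algebra_simps)
qed

text \<open>
  The map is prescribed on a maximal independent subset of \<open>V\<close>. It gives the derivative in all other
  directions, since derivatives along sums and multiples of directions are determined.
\<close>

lemma C1_along_linear:
  assumes "\<And>u. u \<in> V \<Longrightarrow> \<exists>D. C1_along g u D"
  shows "\<exists>T. linear T \<and> (\<forall>u D. u \<in> V \<longrightarrow> C1_along g u D \<longrightarrow> D y = T u)"
proof -
  obtain B where B: "B \<subseteq> V" "independent B" "V \<subseteq> span B"
    using maximal_independent_subset[of V] by blast
  obtain D where D: "\<And>u. u \<in> B \<Longrightarrow> C1_along g u (D u)" using assms B(1) by (metis subsetD)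
  obtain T where T: "linear T" "\<And>b. b \<in> B \<Longrightarrow> T b = D b y"
    using linear_independent_extend[OF B(2), of "\<lambda>b. D b y"] by blast
  have "\<exists>E. C1_along g u E \<and> E y = T u" if "u \<in> span B" for u
    using that
  proof (induction rule: span_induct_alt)
    case base
    show ?case using C1_along_zero linear_0[OF T(1)] by (metis (mono_tags))
  next
    case (step c x u)
    then obtain E where E: "C1_along g u E" "E y = T u" by blast
    have "C1_along g (c *\<^sub>R x + u) (\<lambda>y. c *\<^sub>R D x y + E y)"
      by (intro C1_along_add C1_along_scale D E step)
    moreover have "c *\<^sub>R D x y + E y = T (c *\<^sub>R x + u)"
      using T(2)[OF step(1)] E(2) by (simp add: linear_add[OF T(1)] linear_scale[OF T(1)])
    ultimately show ?case by blast
  qed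
  then show ?thesis using T(1) B(3) C1_along_unique by (metis subsetD)
qed

fun iterated_avg :: "('a \<times> real) list \<Rightarrow> ('a::real_normed_vector \<Rightarrow> 'b::banach) \<Rightarrow> 'a \<Rightarrow> 'b" where
  "iterated_avg [] g = g"
| "iterated_avg ((v, l) # ds) g = avg v l (iterated_avg ds g)"

text \<open>
  The set of displacements over which \<open>iterated_avg\<close> averages: values of the average at \<open>y\<close> depend only on
  values of the function on \<open>y + zonotope ds\<close>.
\<close>

fun zonotope :: "('a::real_normed_vector \<times> real) list \<Rightarrow> 'a set" where
  "zonotope [] = {0}"
| "zonotope ((v, l) # ds) = {a *\<^sub>R v + z | a z. \<bar>a\<bar> \<le> l \<and> z \<in> zonotope ds}"

lemma continuous_iterated_avg: "continuous_on UNIV g \<Longrightarrow> continuous_on UNIV (iterated_avg ds g)"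
  by (induction ds g rule: iterated_avg.induct) (auto intro: continuous_avg)

lemma diffquot_avg:
  assumes g: "continuous_on UNIV g"
  shows "diffquot v l (avg w k g) = avg w k (diffquot v l g)"
proof
  fix y
  have "integral {-k..k} (\<lambda>a. (1 / (2 * l)) *\<^sub>R (g (y + l *\<^sub>R v + a *\<^sub>R w) - g (y - l *\<^sub>R v + a *\<^sub>R w)))
     = (1 / (2 * l)) *\<^sub>R (integral {-k..k} (\<lambda>a. g (y + l *\<^sub>R v + a *\<^sub>R w)) - integral {-k..k} (\<lambda>a. g (y - l *\<^sub>R v + a *\<^sub>R w)))"
    by (simp only: integral_cmul integral_diff[OF integrable_on_line[OF g] integrable_on_line[OF g]])
  moreover have "y + a *\<^sub>R w + l *\<^sub>R v = y + l *\<^sub>R v + a *\<^sub>R w" "y + a *\<^sub>R w - l *\<^sub>R v = y - l *\<^sub>R v + a *\<^sub>R w" for a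
    by simp_all
  ultimately show "diffquot v l (avg w k g) y = avg w k (diffquot v l g) y"
    unfolding diffquot_def avg_def by (simp only: scaleR_diff_right scaleR_scaleR mult.commute)
qed

lemma diffquot_iterated_avg:
  assumes "continuous_on UNIV g"
  shows "diffquot v l (iterated_avg ds g) = iterated_avg ds (diffquot v l g)"
  using assms by (induction ds g rule: iterated_avg.induct) (auto simp: diffquot_avg continuous_iterated_avg)

text \<open>
  Averages in different directions commute with difference quotients, so the derivative along one of the
  directions is the average, over the remaining ones, of a difference quotient of the original
  function. Bounds for the derivative therefore follow from bounds for difference quotients.
\<close>

lemma C1_along_iterated_avg:
  assumes l: "l > 0" and g: "continuous_on UNIV g"
  shows "C1_along (iterated_avg (ds1 @ (v, l) # ds2) g) v (iterated_avg (ds1 @ ds2) (diffquot v l g))"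
proof (induction ds1)
  case Nil
  show ?case using C1_along_avg_same[OF l continuous_iterated_avg[OF g]] by (simp add: diffquot_iterated_avg[OF g])
next
  case (Cons d ds1)
  then show ?case by (cases d) (auto intro: C1_along_avg continuous_iterated_avg g)
qed

lemma norm_iterated_avg_diff_le:
  assumes "continuous_on UNIV g" and "\<And>v l. (v, l) \<in> set ds \<Longrightarrow> l > 0"
    and "\<And>z. z \<in> zonotope ds \<Longrightarrow> norm (g (y + z) - c) \<le> \<eta>"
  shows "norm (iterated_avg ds g y - c) \<le> \<eta>"
  using assms(2,3)
proof (induction ds arbitrary: y)
  case Nil
  then show ?case by simp
next
  case (Cons d ds)
  obtain v l where d: "d = (v, l)" by fastforce
  have "norm (iterated_avg ds g (y + a *\<^sub>R v) - c) \<le> \<eta>" if "\<bar>a\<bar> \<le> l" for a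
  proof (rule Cons.IH)
    fix z assume "z \<in> zonotope ds"
    then have "a *\<^sub>R v + z \<in> zonotope (d # ds)" using that unfolding d by auto
    then show "norm (g (y + a *\<^sub>R v + z) - c) \<le> \<eta>" using Cons.prems(2) by (metis add.assoc)
  qed (use Cons.prems(1) in auto)
  moreover have "l > 0" using Cons.prems(1) unfolding d by auto
  ultimately show ?case
    unfolding d iterated_avg.simps by (intro norm_avg_diff_le continuous_iterated_avg assms(1))
qed

lemma zonotope_append: "zonotope (ds @ es) = {x + y | x y. x \<in> zonotope ds \<and> y \<in> zonotope es}"
proof (induction ds)
  case (Cons d ds)
  then show ?case by (cases d) (auto, metis add.assoc, metis add.assoc)
qed auto

lemma norm_zonotope_le: "z \<in> zonotope ds \<Longrightarrow> norm z \<le> (\<Sum>(v, l)\<leftarrow>ds. l * norm v)"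
proof (induction ds arbitrary: z)
  case (Cons d ds)
  then show ?case
    by (cases d) (auto intro!: norm_triangle_le add_mono mult_right_mono)
qed auto

lemma zonotope_subset_span: "zonotope ds \<subseteq> span (fst ` set ds)"
proof (induction ds)
  case (Cons d ds)
  obtain v l where d: "d = (v, l)" by fastforce
  have "a *\<^sub>R v + z \<in> span (insert v (fst ` set ds))" if "z \<in> zonotope ds" for a z
    using that Cons.IH span_mono[of "fst ` set ds" "insert v (fst ` set ds)"]
    by (intro span_add span_scale) (auto intro: span_base)
  then show ?case unfolding d by auto
qed auto

section \<open>Linear maps from a Lipschitz retraction\<close>

text \<open>
  A partition of unity subordinate to the balls of radius \<open>2H\<close> around a finite net in \<open>span B\<close>. Only
  integrals of the map are taken later, for which continuity is enough.
\<close>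

lemma continuous_near_identity:
  fixes K B :: "'a::real_normed_vector set"
  assumes B: "finite B" and K: "bounded K" and H: "H > 0"
    and near: "\<And>x. x \<in> K \<Longrightarrow> \<exists>t\<in>span B. norm (x - t) < H"
  shows "\<exists>q. continuous_on K q \<and> (\<forall>x\<in>K. q x \<in> span B \<and> norm (q x - x) \<le> 2 * H)"
proof -
  obtain \<rho> where \<rho>: "\<rho> > 0" "\<And>x. x \<in> K \<Longrightarrow> norm x \<le> \<rho>"
    using K by (auto simp: bounded_pos)
  define \<sigma> where "\<sigma> = \<rho> + H"
  have \<sigma>: "\<sigma> > 0" using \<rho> H unfolding \<sigma>_def by simp
  obtain A where A: "finite A" "A \<subseteq> span B"
      "\<And>x. x \<in> span B \<Longrightarrow> norm x \<le> 1 \<Longrightarrow> \<exists>a\<in>A. norm (x - a) < H / \<sigma>"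
  proof -
    have "H / \<sigma> > 0" using H \<sigma> by simp
    from finite_net[OF B this, of "span B \<inter> cball 0 1"] show ?thesis using that by auto
  qed
  define Y where "Y = (\<lambda>a. \<sigma> *\<^sub>R a) ` A"
  have Y: "finite Y" "Y \<subseteq> span B" using A unfolding Y_def by (auto intro: span_scale)
  have net: "\<exists>y\<in>Y. norm (x - y) < 2 * H" if x: "x \<in> K" for x
  proof -
    obtain t where t: "t \<in> span B" "norm (x - t) < H" using near[OF x] by blast
    have "norm t \<le> \<sigma>" using norm_triangle_sub[of t x] t(2) \<rho>(2)[OF x] unfolding \<sigma>_def by (simp add: norm_minus_commute)
    then have "norm ((1/\<sigma>) *\<^sub>R t) \<le> 1" using \<sigma> by simp
    then obtain a where a: "a \<in> A" "norm ((1/\<sigma>) *\<^sub>R t - a) < H / \<sigma>"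
      using A(3)[of "(1/\<sigma>) *\<^sub>R t"] t(1) span_scale by blast
    have "t - \<sigma> *\<^sub>R a = \<sigma> *\<^sub>R ((1/\<sigma>) *\<^sub>R t - a)" using \<sigma> by (simp add: algebra_simps)
    then have "norm (t - \<sigma> *\<^sub>R a) = \<sigma> * norm ((1/\<sigma>) *\<^sub>R t - a)" using \<sigma> by (metis abs_of_pos norm_scaleR)
    then have "norm (t - \<sigma> *\<^sub>R a) < H" using a(2) \<sigma> by (simp add: pos_less_divide_eq mult.commute)
    then have "norm (x - \<sigma> *\<^sub>R a) < 2 * H"
      using norm_triangle_ineq[of "x - t" "t - \<sigma> *\<^sub>R a"] t(2) by simp
    then show ?thesis using a(1) unfolding Y_def by blast
  qed
  define \<phi> where "\<phi> y x = max 0 (2 * H - norm (x - y))" for x y :: 'a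
  define \<Phi> where "\<Phi> x = (\<Sum>y\<in>Y. \<phi> y x)" for x
  define q where "q x = (1 / \<Phi> x) *\<^sub>R (\<Sum>y\<in>Y. \<phi> y x *\<^sub>R y)" for x
  have \<phi>0: "\<phi> y x \<ge> 0" for x y unfolding \<phi>_def by simp
  have \<Phi>: "\<Phi> x > 0" if x: "x \<in> K" for x
  proof -
    obtain y where "y \<in> Y" "norm (x - y) < 2 * H" using net[OF x] by blast
    then show ?thesis unfolding \<Phi>_def
      by (intro sum_pos2[OF Y(1)]) (auto simp: \<phi>_def)
  qed
  have "continuous_on K q"
    unfolding q_def \<Phi>_def \<phi>_def
    by (intro continuous_intros) (use \<Phi> in \<open>auto simp: \<Phi>_def \<phi>_def less_le\<close>)
  moreover have "q x \<in> span B" for x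
    unfolding q_def using Y(2) by (intro span_scale span_sum) auto
  moreover have "norm (q x - x) \<le> 2 * H" if x: "x \<in> K" for x
  proof -
    have "q x - x = (1 / \<Phi> x) *\<^sub>R (\<Sum>y\<in>Y. \<phi> y x *\<^sub>R (y - x))"
      using \<Phi>[OF x] unfolding q_def
      by (simp add: scaleR_diff_right sum_subtractf flip: scaleR_left.sum) (simp add: \<Phi>_def)
    moreover have "norm (\<Sum>y\<in>Y. \<phi> y x *\<^sub>R (y - x)) \<le> (\<Sum>y\<in>Y. \<phi> y x * (2 * H))"
    proof (rule sum_norm_le)
      fix y
      show "norm (\<phi> y x *\<^sub>R (y - x)) \<le> \<phi> y x * (2 * H)"
        by (cases "norm (x - y) < 2 * H") (auto simp: \<phi>_def norm_minus_commute intro!: mult_left_mono)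
    qed
    moreover have "(\<Sum>y\<in>Y. \<phi> y x * (2 * H)) = \<Phi> x * (2 * H)" unfolding \<Phi>_def by (simp only: sum_distrib_right)
    ultimately show ?thesis using \<Phi>[OF x] by (simp add: pos_divide_le_eq mult_ac)
  qed
  ultimately show ?thesis by blast
qed

text \<open>
  For a bounded projection \<open>P\<close> onto a finite-dimensional subspace this says that averages of a function
  with values in the subspace stay there: \<open>P\<close> commutes with the integral.
\<close>

lemma iterated_avg_fixed:
  assumes P: "bounded_linear P" and g: "continuous_on UNIV g" and fixed: "\<And>y. P (g y) = g y"
  shows "P (iterated_avg ds g y) = iterated_avg ds g y"
proof (induction ds arbitrary: y)
  case Nil
  then show ?case by (simp add: fixed)
next
  case (Cons d ds)
  obtain v l where d: "d = (v, l)" by fastforce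
  have "P (integral {-l..l} (\<lambda>a. iterated_avg ds g (y + a *\<^sub>R v))) = integral {-l..l} (P \<circ> (\<lambda>a. iterated_avg ds g (y + a *\<^sub>R v)))"
    by (intro integral_linear[symmetric] integrable_on_line continuous_iterated_avg g P)
  then show ?case
    unfolding d by (simp add: avg_def o_def Cons.IH linear_scale[OF bounded_linear.linear[OF P]])
qed

text \<open>
  The passage from the nonlinear retraction to a linear map. The map \<open>T\<close> is the derivative at \<open>y0\<close> of an
  average of \<open>g = q \<circ> R\<close>. In a direction \<open>v \<in> V\<close> the difference quotient of \<open>g\<close> over a segment of
  half-length \<open>2H\<close> is at most \<open>L\<close> plus twice the error \<open>2H\<close> divided by the length \<open>4H\<close>. In a
  direction \<open>w \<in> W\<close> the end points of the segments stay within \<open>2H card V\<close> of points of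
  \<open>y0 + span W\<close> at which \<open>R\<close> is the identity, so the difference quotient is close to \<open>w\<close>.
\<close>

lemma linear_from_retraction:
  fixes K B V W :: "'a::banach set"
  assumes lip: "L-lipschitz_on UNIV R" and RK: "\<And>x. R x \<in> K" and fixK: "\<And>x. x \<in> K \<Longrightarrow> R x = x"
    and B: "finite B" and K: "bounded K" and H: "H > 0"
    and near: "\<And>x. x \<in> K \<Longrightarrow> \<exists>t\<in>span B. norm (x - t) < H"
    and V: "finite V" "\<And>v. v \<in> V \<Longrightarrow> norm v \<le> 1"
    and W: "finite W" and r: "r > 0" and r': "r' > 0" "r' * (\<Sum>w\<in>W. norm w) \<le> r"
    and int: "\<And>z. z \<in> span W \<Longrightarrow> norm z \<le> r \<Longrightarrow> y0 + z \<in> K"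
  shows "\<exists>T. linear T \<and> (\<forall>u\<in>V \<union> W. T u \<in> span B) \<and> (\<forall>v\<in>V. norm (T v) \<le> L + 1) \<and>
           (\<forall>w\<in>W. norm (T w - w) \<le> (L * (2 * H * card V) + 2 * H) / r')"
proof -
  have L0: "L \<ge> 0" using lip by (rule lipschitz_on_nonneg)
  obtain q where q: "continuous_on K q" "\<And>x. x \<in> K \<Longrightarrow> q x \<in> span B" "\<And>x. x \<in> K \<Longrightarrow> norm (q x - x) \<le> 2 * H"
    using continuous_near_identity[OF B K H near] by blast
  define g where "g x = q (R x)" for x
  have g: "continuous_on UNIV g"
    unfolding g_def
    by (rule continuous_on_compose2[OF q(1) lipschitz_on_continuous_on[OF lip]]) (use RK in auto)
  have gR: "norm (g x - R x) \<le> 2 * H" for x unfolding g_def by (rule q(3)[OF RK])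
  have RR: "norm (R x - R y) \<le> L * norm (x - y)" for x y
    using lipschitz_onD[OF lip, of x y] by (simp add: dist_norm)
  obtain \<theta> where \<theta>: "\<And>b. bounded_linear (\<theta> b :: 'a \<Rightarrow> real)" "\<And>x. x \<in> span B \<Longrightarrow> (\<Sum>b\<in>B. \<theta> b x *\<^sub>R b) = x"
    using bounded_coordinates[OF B] by blast
  define P where "P x = (\<Sum>b\<in>B. \<theta> b x *\<^sub>R b)" for x
  have P: "bounded_linear P" unfolding P_def by (intro bounded_linear_sum bounded_linear_scaleR_const \<theta>)
  have Pspan: "P x \<in> span B" for x unfolding P_def by (intro span_sum span_scale span_base)
  have Pg: "P (diffquot u l g y) = diffquot u l g y" for u l y
  proof -
    have "diffquot u l g y \<in> span B"
      unfolding diffquot_def g_def by (intro span_scale span_diff q(2) RK)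
    from \<theta>(2)[OF this] show ?thesis unfolding P_def .
  qed
  obtain vs where vs: "set vs = V" "distinct vs" using finite_distinct_list[OF V(1)] by blast
  obtain ws where ws: "set ws = W" "distinct ws" using finite_distinct_list[OF W] by blast
  define dv where "dv = map (\<lambda>v. (v, 2 * H)) vs"
  define dw where "dw us = map (\<lambda>w. (w, r')) us" for us :: "'a list"
  define ds where "ds = dv @ dw ws"
  have along: "\<exists>D. C1_along (iterated_avg ds g) u D" if u: "u \<in> V \<union> W" for u
  proof -
    have "(u, 2 * H) \<in> set ds \<or> (u, r') \<in> set ds"
      using u vs(1) ws(1) unfolding ds_def dv_def dw_def by auto
    then obtain l where "(u, l) \<in> set ds" "l > 0" using r'(1) H by force
    then obtain ds1 ds2 where "ds = ds1 @ (u, l) # ds2" using split_list by metis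
    then show ?thesis using C1_along_iterated_avg[OF \<open>l > 0\<close> g, of ds1 u ds2] by blast
  qed
  obtain T where T: "linear T" "\<And>u D. u \<in> V \<union> W \<Longrightarrow> C1_along (iterated_avg ds g) u D \<Longrightarrow> D y0 = T u"
    using C1_along_linear[of "V \<union> W" "iterated_avg ds g" y0] along by blast
  have Teq: "T u = iterated_avg (ds1 @ ds2) (diffquot u l g) y0" if "u \<in> V \<union> W" "ds = ds1 @ (u, l) # ds2" "l > 0" for u l ds1 ds2
    using T(2)[OF that(1)] C1_along_iterated_avg[OF that(3) g, of ds1 u ds2] unfolding that(2) by simp
  have pos: "l > 0" if "(u, l) \<in> set ds" for u l
    using that H r'(1) unfolding ds_def dv_def dw_def by auto
  have TB: "T u \<in> span B" if u: "u \<in> V \<union> W" for u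
  proof -
    obtain l where l: "(u, l) \<in> set ds"
      using u vs(1) ws(1) unfolding ds_def dv_def dw_def by auto
    obtain ds1 ds2 where "ds = ds1 @ (u, l) # ds2" using split_list[OF l] by blast
    from Teq[OF u this pos[OF l]] have "P (T u) = T u"
      by (simp add: iterated_avg_fixed[OF P continuous_diffquot[OF g] Pg])
    then show ?thesis using Pspan[of "T u"] by simp
  qed
  have TV: "norm (T v) \<le> L + 1" if v: "v \<in> V" for v
  proof -
    have l: "(v, 2 * H) \<in> set ds" using v vs(1) unfolding ds_def dv_def by auto
    obtain ds1 ds2 where ds12: "ds = ds1 @ (v, 2 * H) # ds2" using split_list[OF l] by blast
    have "norm (diffquot v (2 * H) g y - 0) \<le> L + 1" for y
    proof -
      define a where "a = y + (2 * H) *\<^sub>R v"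
      define b where "b = y - (2 * H) *\<^sub>R v"
      have "norm (R a - R b) \<le> L * norm (a - b)" by (rule RR)
      also have "a - b = (4 * H) *\<^sub>R v" unfolding a_def b_def by (simp add: algebra_simps flip: scaleR_left_distrib)
      also have "L * norm ((4 * H) *\<^sub>R v) \<le> L * (4 * H)"
        using H L0 V(2)[OF v] by (intro mult_left_mono) auto
      finally have "norm (g a - g b) \<le> L * (4 * H) + 4 * H"
        using gR[of a] gR[of b] norm_triangle_ineq[of "g a - R a" "R a - g b"]
          norm_triangle_ineq[of "R a - R b" "R b - g b"] by (simp add: norm_minus_commute)
      moreover have "norm (diffquot v (2 * H) g y) = norm (g a - g b) / (4 * H)"
        using H unfolding diffquot_def a_def[symmetric] b_def[symmetric] by simp
      ultimately show ?thesis using H by (simp add: pos_divide_le_eq algebra_simps)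
    qed
    then have "norm (iterated_avg (ds1 @ ds2) (diffquot v (2 * H) g) y0 - 0) \<le> L + 1"
      by (intro norm_iterated_avg_diff_le continuous_diffquot g) (use pos ds12 in auto)
    then show ?thesis using Teq[OF _ ds12] v H by simp
  qed
  have TW: "norm (T w - w) \<le> (L * (2 * H * card V) + 2 * H) / r'" if w: "w \<in> W" for w
  proof -
    define s where "s = 2 * H * card V"
    obtain ws1 ws2 where ws12: "ws = ws1 @ w # ws2" using w ws(1) split_list by metis
    have ds12: "ds = (dv @ dw ws1) @ (w, r') # dw ws2" unfolding ds_def dw_def ws12 by simp
    have "norm (diffquot w r' g (y0 + z) - w) \<le> (L * s + 2 * H) / r'" if z: "z \<in> zonotope ((dv @ dw ws1) @ dw ws2)" for z
    proof -
      have eq: "(dv @ dw ws1) @ dw ws2 = dv @ dw (ws1 @ ws2)" unfolding dw_def by simp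
      \<comment> \<open>The part \<open>x\<close> along \<open>V\<close> is a small error; the part \<open>y\<close> along \<open>W\<close> is large but
        stays in the region where \<open>R\<close> is the identity.\<close>
      obtain x y where xy: "z = x + y" "x \<in> zonotope dv" "y \<in> zonotope (dw (ws1 @ ws2))"
        using z unfolding eq zonotope_append by blast
      have "norm x \<le> (\<Sum>v\<leftarrow>vs. 2 * H * norm v)"
        using norm_zonotope_le[OF xy(2)] unfolding dv_def by (simp add: o_def)
      also have "\<dots> = (\<Sum>v\<in>V. 2 * H * norm v)" using vs by (simp add: sum_list_distinct_conv_sum_set)
      also have "\<dots> \<le> (\<Sum>v\<in>V. 2 * H * 1)" using V(2) H by (intro sum_mono mult_left_mono) auto
      finally have x: "norm x \<le> s" unfolding s_def by (simp add: mult.commute)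
      have "norm y \<le> (\<Sum>v\<leftarrow>ws1 @ ws2. r' * norm v)"
        using norm_zonotope_le[OF xy(3)] unfolding dw_def by (simp add: o_def)
      then have "norm y + r' * norm w \<le> (\<Sum>v\<leftarrow>ws. r' * norm v)" unfolding ws12 by simp
      also have "\<dots> = (\<Sum>w\<in>W. r' * norm w)" using ws by (simp add: sum_list_distinct_conv_sum_set)
      also have "\<dots> \<le> r" using r'(2) by (simp add: sum_distrib_left)
      finally have yr: "norm y + r' * norm w \<le> r" .
      have "y \<in> span W"
      proof -
        have "fst ` set (dw (ws1 @ ws2)) \<subseteq> W" using ws(1) unfolding dw_def ws12 by auto
        from span_mono[OF this] show ?thesis using xy(3) zonotope_subset_span by blast
      qed
      have in_K: "y0 + (y + c *\<^sub>R w) \<in> K" if "\<bar>c\<bar> = r'" for c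
        using yr that norm_triangle_ineq[of y "c *\<^sub>R w"] \<open>y \<in> span W\<close> w
        by (intro int span_add span_scale) (auto intro: span_base)
      have close: "norm (g (y0 + z + c *\<^sub>R w) - (y0 + (y + c *\<^sub>R w))) \<le> L * s + 2 * H" if "\<bar>c\<bar> = r'" for c
      proof -
        have "norm (R (y0 + z + c *\<^sub>R w) - R (y0 + (y + c *\<^sub>R w))) \<le> L * norm x"
          using RR[of "y0 + z + c *\<^sub>R w" "y0 + (y + c *\<^sub>R w)"] unfolding xy(1) by (simp add: algebra_simps)
        also have "\<dots> \<le> L * s" using x L0 by (rule mult_left_mono)
        finally show ?thesis
          using norm_diff_triangle_le[OF gR[of "y0 + z + c *\<^sub>R w"]] unfolding fixK[OF in_K[OF that]] add.commute[of "L * s"]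
          by blast
      qed
      define a b where "a = g (y0 + z + r' *\<^sub>R w) - (y0 + (y + r' *\<^sub>R w))"
        and "b = g (y0 + z - r' *\<^sub>R w) - (y0 + (y - r' *\<^sub>R w))"
      have ab: "norm a \<le> L * s + 2 * H" "norm b \<le> L * s + 2 * H"
        using close[of r'] close[of "-r'"] r'(1) unfolding a_def b_def by auto
      have "g (y0 + z + r' *\<^sub>R w) - g (y0 + z - r' *\<^sub>R w) = (a - b) + (2 * r') *\<^sub>R w"
        unfolding a_def b_def by (simp add: algebra_simps flip: scaleR_left_distrib)
      then have "diffquot w r' g (y0 + z) - w = (1 / (2 * r')) *\<^sub>R (a - b)"
        using r'(1) unfolding diffquot_def by (simp add: scaleR_add_right)
      then have "norm (diffquot w r' g (y0 + z) - w) = norm (a - b) / (2 * r')"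
        using r'(1) by simp
      moreover have "norm (a - b) \<le> 2 * (L * s + 2 * H)"
        using order_trans[OF norm_triangle_ineq4 add_mono[OF ab]] by (simp only: mult_2)
      ultimately show ?thesis using r'(1) by (simp add: field_simps del: norm_scaleR)
    qed
    then have "norm (iterated_avg ((dv @ dw ws1) @ dw ws2) (diffquot w r' g) y0 - w) \<le> (L * s + 2 * H) / r'"
      by (intro norm_iterated_avg_diff_le continuous_diffquot g) (use pos ds12 in auto)
    then show ?thesis using Teq[OF _ ds12 r'(1)] w unfolding s_def by simp
  qed
  show ?thesis using T(1) TB TV TW by blast
qed

section \<open>From trace estimates to operators on the whole space\<close>

text \<open>
  The Hahn-Banach theorem is applied below to pairs of families of vectors, so functions must form a real
  vector space.
\<close>

instantiation "fun" :: (type, real_vector) real_vector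
begin

definition scaleR_fun :: "real \<Rightarrow> ('a \<Rightarrow> 'b) \<Rightarrow> 'a \<Rightarrow> 'b" where
  "scaleR_fun c f = (\<lambda>x. c *\<^sub>R f x)"

instance
  by standard (auto simp: scaleR_fun_def fun_eq_iff algebra_simps)

end

lemma scaleR_fun_apply: "(c *\<^sub>R f) x = c *\<^sub>R f x"
  by (simp add: scaleR_fun_def)

text \<open>
  The functionals \<open>\<theta> b\<close> are coordinates on \<open>span B\<close>. For independent \<open>B\<close> the left-hand side is the trace
  of the linear map \<open>A : b \<mapsto> z b\<close> from \<open>span B\<close> to \<open>span W\<close>, written as \<open>\<Sum>\<^sub>y f\<^sub>y \<otimes> x\<^sub>y\<close> plus a remainder \<open>r\<close>. The trace of
  \<open>T \<circ> A\<close> is \<open>\<Sum>\<^sub>y f\<^sub>y (T x\<^sub>y)\<close> plus the contribution of \<open>r\<close>, so it is controlled by the size of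
  \<open>T\<close> on the vectors \<open>x\<^sub>y\<close> and \<open>r b\<close> alone. The trace of \<open>(T - id) \<circ> A\<close> is computed on \<open>span W\<close> instead,
  where only the few vectors \<open>T w - w\<close> enter. The sums that express these traces in the coordinates \<open>\<theta>\<close>
  obey the same rules for dependent \<open>B\<close>.
\<close>

lemma trace_estimate:
  fixes B W Y :: "'a::real_normed_vector set" and \<theta> \<omega> f :: "'a \<Rightarrow> 'a \<Rightarrow> real" and \<kappa> \<eta> C :: real
  assumes B: "finite B" and W: "finite W" "W \<subseteq> span B" and Y: "finite Y"
    and \<theta>: "\<And>b. linear (\<theta> b)" "\<And>x. x \<in> span B \<Longrightarrow> (\<Sum>b\<in>B. \<theta> b x *\<^sub>R b) = x"
    and \<theta>_le: "\<And>b x. b \<in> B \<Longrightarrow> \<bar>\<theta> b x\<bar> \<le> \<Theta> * norm x" and \<Theta>: "\<Theta> \<ge> 0"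
    and \<omega>: "\<And>w. linear (\<omega> w)" "\<And>x. x \<in> span W \<Longrightarrow> (\<Sum>w\<in>W. \<omega> w x *\<^sub>R w) = x"
    and \<omega>_le: "\<And>w x. w \<in> W \<Longrightarrow> \<bar>\<omega> w x\<bar> \<le> \<kappa> * norm x" and \<kappa>: "\<kappa> \<ge> 0"
    and f: "\<And>y. linear (f y)" "\<And>y x. \<bar>f y x\<bar> \<le> norm x"
    and T: "linear T" "\<And>y. y \<in> Y \<Longrightarrow> T (x y) \<in> span B" "\<And>b. b \<in> B \<Longrightarrow> T (r b) \<in> span B"
      "\<And>w. w \<in> W \<Longrightarrow> T w \<in> span B"
      "\<And>y. y \<in> Y \<Longrightarrow> norm (T (x y)) \<le> C * norm (x y)" "\<And>b. b \<in> B \<Longrightarrow> norm (T (r b)) \<le> C * norm (r b)"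
      "\<And>w. w \<in> W \<Longrightarrow> norm (T w - w) \<le> \<eta>"
    and z: "\<And>b. b \<in> B \<Longrightarrow> z b = r b + (\<Sum>y\<in>Y. f y b *\<^sub>R x y)" "\<And>b. b \<in> B \<Longrightarrow> z b \<in> span W"
  shows "(\<Sum>b\<in>B. \<theta> b (z b)) \<le> (C + card W * \<kappa> * \<eta>) * ((\<Sum>y\<in>Y. norm (x y)) + \<Theta> * (\<Sum>b\<in>B. norm (r b)))"
proof -
  define N where "N = (\<Sum>y\<in>Y. norm (x y)) + \<Theta> * (\<Sum>b\<in>B. norm (r b))"
  \<comment> \<open>Expanding a functional on \<open>span B\<close> in the coordinates \<open>\<theta>\<close> is what exchanges
    the two ways to compute a trace.\<close>
  have fB: "f y v = (\<Sum>b\<in>B. \<theta> b v * f y b)" if "v \<in> span B" for y v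
    using arg_cong[OF \<theta>(2)[OF that], of "f y"] by (simp add: linear_sum[OF f(1)] linear_scale[OF f(1)])
  have swap: "(\<Sum>b\<in>B. \<Sum>y\<in>Y. f y b * h b (x y)) = (\<Sum>y\<in>Y. \<Sum>b\<in>B. h b (x y) * f y b)" for h :: "'a \<Rightarrow> 'a \<Rightarrow> real"
    by (subst sum.swap) (simp add: mult.commute)
  have Tz: "(\<Sum>b\<in>B. \<theta> b (T (z b))) = (\<Sum>b\<in>B. \<theta> b (T (r b))) + (\<Sum>y\<in>Y. f y (T (x y)))"
  proof -
    have "(\<Sum>b\<in>B. \<theta> b (T (z b))) = (\<Sum>b\<in>B. \<theta> b (T (r b)) + (\<Sum>y\<in>Y. f y b * \<theta> b (T (x y))))"
      by (intro sum.cong refl)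
         (simp add: z(1) linear_add[OF T(1)] linear_sum[OF T(1)] linear_scale[OF T(1)]
            linear_add[OF \<theta>(1)] linear_sum[OF \<theta>(1)] linear_scale[OF \<theta>(1)])
    also have "\<dots> = (\<Sum>b\<in>B. \<theta> b (T (r b))) + (\<Sum>y\<in>Y. \<Sum>b\<in>B. \<theta> b (T (x y)) * f y b)"
      unfolding sum.distrib by (simp add: swap[of "\<lambda>b u. \<theta> b (T u)"])
    also have "(\<Sum>y\<in>Y. \<Sum>b\<in>B. \<theta> b (T (x y)) * f y b) = (\<Sum>y\<in>Y. f y (T (x y)))"
      by (intro sum.cong refl) (simp add: fB[OF T(2)])
    finally show ?thesis .
  qed
  have main: "(\<Sum>b\<in>B. \<theta> b (T (z b))) \<le> C * N"
  proof -
    have "(\<Sum>b\<in>B. \<theta> b (T (r b))) \<le> (\<Sum>b\<in>B. \<Theta> * (C * norm (r b)))"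
    proof (rule sum_mono)
      fix b assume b: "b \<in> B"
      have "\<theta> b (T (r b)) \<le> \<Theta> * norm (T (r b))" using \<theta>_le[OF b, of "T (r b)"] by linarith
      also have "\<dots> \<le> \<Theta> * (C * norm (r b))" using T(6)[OF b] \<Theta> by (rule mult_left_mono)
      finally show "\<theta> b (T (r b)) \<le> \<Theta> * (C * norm (r b))" .
    qed
    moreover have "(\<Sum>y\<in>Y. f y (T (x y))) \<le> (\<Sum>y\<in>Y. C * norm (x y))"
    proof (rule sum_mono)
      fix y assume y: "y \<in> Y"
      show "f y (T (x y)) \<le> C * norm (x y)" using f(2)[of y "T (x y)"] T(5)[OF y] by linarith
    qed
    ultimately show ?thesis
      unfolding Tz N_def by (simp add: algebra_simps sum_distrib_left)
  qed
  define U where "U v = T v - v" for v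
  have U: "linear U" unfolding U_def using T(1) by (intro linear_compose_sub) (auto simp: linear_iff)
  have UW: "U w \<in> span B" if "w \<in> W" for w using T(4)[OF that] W(2) that unfolding U_def by (auto intro: span_diff)
  have Uz: "(\<Sum>b\<in>B. \<theta> b (U (z b))) = (\<Sum>w\<in>W. (\<Sum>b\<in>B. \<omega> w (r b) * \<theta> b (U w)) + (\<Sum>y\<in>Y. f y (U w) * \<omega> w (x y)))"
  proof -
    have "(\<Sum>b\<in>B. \<theta> b (U (z b))) = (\<Sum>b\<in>B. \<Sum>w\<in>W. \<omega> w (z b) * \<theta> b (U w))"
    proof (intro sum.cong refl)
      fix b assume "b \<in> B"
      have "\<theta> b (U (z b)) = \<theta> b (U (\<Sum>w\<in>W. \<omega> w (z b) *\<^sub>R w))" using \<omega>(2)[OF z(2)[OF \<open>b \<in> B\<close>]] by simp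
      also have "\<dots> = (\<Sum>w\<in>W. \<omega> w (z b) * \<theta> b (U w))"
        by (simp add: linear_sum[OF U] linear_scale[OF U] linear_sum[OF \<theta>(1)] linear_scale[OF \<theta>(1)])
      finally show "\<theta> b (U (z b)) = (\<Sum>w\<in>W. \<omega> w (z b) * \<theta> b (U w))" .
    qed
    also have "\<dots> = (\<Sum>w\<in>W. \<Sum>b\<in>B. \<omega> w (z b) * \<theta> b (U w))" by (rule sum.swap)
    also have "\<dots> = (\<Sum>w\<in>W. (\<Sum>b\<in>B. \<omega> w (r b) * \<theta> b (U w)) + (\<Sum>y\<in>Y. f y (U w) * \<omega> w (x y)))"
    proof (intro sum.cong refl)
      fix w assume w: "w \<in> W"
      have "(\<Sum>b\<in>B. \<omega> w (z b) * \<theta> b (U w)) = (\<Sum>b\<in>B. \<omega> w (r b) * \<theta> b (U w) + (\<Sum>y\<in>Y. f y b * (\<omega> w (x y) * \<theta> b (U w))))"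
        by (intro sum.cong refl)
           (simp add: z(1) linear_add[OF \<omega>(1)] linear_sum[OF \<omega>(1)] linear_scale[OF \<omega>(1)] distrib_right sum_distrib_right mult.assoc)
      also have "\<dots> = (\<Sum>b\<in>B. \<omega> w (r b) * \<theta> b (U w)) + (\<Sum>y\<in>Y. \<Sum>b\<in>B. (\<omega> w (x y) * \<theta> b (U w)) * f y b)"
        unfolding sum.distrib by (simp add: swap[of "\<lambda>b u. \<omega> w u * \<theta> b (U w)"])
      also have "(\<Sum>y\<in>Y. \<Sum>b\<in>B. (\<omega> w (x y) * \<theta> b (U w)) * f y b) = (\<Sum>y\<in>Y. f y (U w) * \<omega> w (x y))"
        by (intro sum.cong refl) (simp add: fB[OF UW[OF w]] sum_distrib_left sum_distrib_right mult_ac)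
      finally show "(\<Sum>b\<in>B. \<omega> w (z b) * \<theta> b (U w)) = (\<Sum>b\<in>B. \<omega> w (r b) * \<theta> b (U w)) + (\<Sum>y\<in>Y. f y (U w) * \<omega> w (x y))" .
    qed
    finally show ?thesis .
  qed
  have "- (\<kappa> * \<eta> * N) \<le> (\<Sum>b\<in>B. \<omega> w (r b) * \<theta> b (U w)) + (\<Sum>y\<in>Y. f y (U w) * \<omega> w (x y))" if w: "w \<in> W" for w
  proof -
    have \<eta>: "norm (U w) \<le> \<eta>" "\<eta> \<ge> 0" using T(7)[OF w] norm_ge_zero[of "T w - w"] unfolding U_def by linarith+
    have "- (\<Theta> * \<kappa> * \<eta> * norm (r b)) \<le> \<omega> w (r b) * \<theta> b (U w)" if b: "b \<in> B" for b
    proof -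
      have "\<bar>\<theta> b (U w)\<bar> \<le> \<Theta> * \<eta>"
        using \<theta>_le[OF b, of "U w"] mult_left_mono[OF \<eta>(1) \<Theta>] by linarith
      then have "\<bar>\<omega> w (r b) * \<theta> b (U w)\<bar> \<le> (\<kappa> * norm (r b)) * (\<Theta> * \<eta>)"
        unfolding abs_mult using \<omega>_le[OF w, of "r b"] \<kappa> by (intro mult_mono) auto
      then show ?thesis by (simp add: mult_ac abs_le_iff)
    qed
    then have "(\<Sum>b\<in>B. - (\<Theta> * \<kappa> * \<eta> * norm (r b))) \<le> (\<Sum>b\<in>B. \<omega> w (r b) * \<theta> b (U w))" by (rule sum_mono)
    moreover have "- (\<kappa> * \<eta> * norm (x y)) \<le> f y (U w) * \<omega> w (x y)" for y
    proof -
      have "\<bar>f y (U w) * \<omega> w (x y)\<bar> \<le> \<eta> * (\<kappa> * norm (x y))"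
        unfolding abs_mult using \<omega>_le[OF w, of "x y"] f(2)[of y "U w"] \<eta> by (intro mult_mono) auto
      then show ?thesis by (simp add: mult_ac abs_le_iff)
    qed
    then have "(\<Sum>y\<in>Y. - (\<kappa> * \<eta> * norm (x y))) \<le> (\<Sum>y\<in>Y. f y (U w) * \<omega> w (x y))" by (intro sum_mono)
    ultimately show ?thesis
      unfolding N_def by (simp add: algebra_simps sum_distrib_left sum_negf)
  qed
  then have "(\<Sum>w\<in>W. - (\<kappa> * \<eta> * N)) \<le> (\<Sum>b\<in>B. \<theta> b (U (z b)))" unfolding Uz by (rule sum_mono)
  moreover have "(\<Sum>b\<in>B. \<theta> b (U (z b))) = (\<Sum>b\<in>B. \<theta> b (T (z b))) - (\<Sum>b\<in>B. \<theta> b (z b))"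
    unfolding U_def by (simp add: linear_diff[OF \<theta>(1)] sum_subtractf)
  ultimately have "(\<Sum>b\<in>B. \<theta> b (z b)) \<le> C * N + card W * \<kappa> * \<eta> * N" using main by (simp add: algebra_simps)
  then show ?thesis unfolding N_def by (simp add: algebra_simps)
qed

text \<open>
  The dual of the trace inequality. A pair \<open>(x, r)\<close> represents the family \<open>\<sigma> (x, r)\<close> with entries
  \<open>r b + \<Sum>\<^sub>y f\<^sub>y(b) x\<^sub>y\<close>, and its trace is defined on the subspace \<open>S\<close> of pairs for which the images lie
  in \<open>span W\<close>. A dominated extension \<open>\<Lambda>\<close> of the trace is a pair of families of functionals. The
  functionals belonging to \<open>r\<close> are the coordinates of \<open>T\<close>; those belonging to \<open>x\<close> must be \<open>f\<^sub>y \<circ> T\<close>,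
  because \<open>\<Lambda>\<close> vanishes on all pairs that represent the zero family. Their bounds are the
  domination of \<open>\<Lambda>\<close>. The remainder \<open>r\<close> makes every family representable even if the \<open>f\<^sub>y\<close> do not span the
  dual of \<open>span B\<close>.
\<close>

lemma operator_from_trace_estimate:
  fixes B W Y :: "'a::real_normed_vector set" and \<theta> f :: "'a \<Rightarrow> 'a \<Rightarrow> real"
  assumes B: "finite B" and W: "W \<subseteq> span B" and Y: "finite Y"
    and \<theta>: "\<And>b. linear (\<theta> b)" "\<And>x. x \<in> span B \<Longrightarrow> (\<Sum>b\<in>B. \<theta> b x *\<^sub>R b) = x"
    and \<Theta>: "\<Theta> \<ge> 0" and C: "C \<ge> 0"
    and f: "\<And>y. linear (f y)"
    and trace: "\<And>x r. (\<And>b. b \<in> B \<Longrightarrow> r b + (\<Sum>y\<in>Y. f y b *\<^sub>R x y) \<in> span W) \<Longrightarrow>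
      (\<Sum>b\<in>B. \<theta> b (r b + (\<Sum>y\<in>Y. f y b *\<^sub>R x y))) \<le> C * ((\<Sum>y\<in>Y. norm (x y)) + \<Theta> * (\<Sum>b\<in>B. norm (r b)))"
  shows "\<exists>T. linear T \<and> range T \<subseteq> span B \<and> (\<forall>w\<in>span W. T w = w) \<and> (\<forall>y\<in>Y. \<forall>u. \<bar>f y (T u)\<bar> \<le> C * norm u)"
proof -
  define \<sigma> where "\<sigma> p b = snd p b + (\<Sum>y\<in>Y. f y b *\<^sub>R fst p y)" for p :: "('a \<Rightarrow> 'a) \<times> ('a \<Rightarrow> 'a)" and b
  define S where "S = {p. \<forall>b\<in>B. \<sigma> p b \<in> span W}"
  define \<tau> where "\<tau> p = (\<Sum>b\<in>B. \<theta> b (\<sigma> p b))" for p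
  define N where "N p = C * ((\<Sum>y\<in>Y. norm (fst p y)) + \<Theta> * (\<Sum>b\<in>B. norm (snd p b)))" for p :: "('a \<Rightarrow> 'a) \<times> ('a \<Rightarrow> 'a)"
  have \<sigma>_add: "\<sigma> (p + q) b = \<sigma> p b + \<sigma> q b" and \<sigma>_scale: "\<sigma> (c *\<^sub>R p) b = c *\<^sub>R \<sigma> p b" for p q b c
    unfolding \<sigma>_def by (simp_all add: scaleR_fun_apply sum.distrib scaleR_sum_right algebra_simps)
  have "subspace S"
    unfolding S_def
    by (rule subspaceI) (auto simp: \<sigma>_add \<sigma>_scale span_add span_scale, simp add: \<sigma>_def span_zero)
  moreover have "linear \<tau>"
    unfolding \<tau>_def
    by (rule linearI) (simp_all add: \<sigma>_add \<sigma>_scale linear_add[OF \<theta>(1)] linear_scale[OF \<theta>(1)] sum.distrib sum_distrib_left)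
  moreover have "\<tau> p \<le> N p" if "p \<in> S" for p
    using trace[of "snd p" "fst p"] that unfolding \<tau>_def N_def S_def \<sigma>_def by simp
  moreover have "N (p + q) \<le> N p + N q" for p q
  proof -
    have "(\<Sum>y\<in>Y. norm (fst (p + q) y)) \<le> (\<Sum>y\<in>Y. norm (fst p y)) + (\<Sum>y\<in>Y. norm (fst q y))"
      "(\<Sum>b\<in>B. norm (snd (p + q) b)) \<le> (\<Sum>b\<in>B. norm (snd p b)) + (\<Sum>b\<in>B. norm (snd q b))"
      unfolding sum.distrib[symmetric] by (auto intro!: sum_mono norm_triangle_ineq)
    then have "(\<Sum>y\<in>Y. norm (fst (p + q) y)) + \<Theta> * (\<Sum>b\<in>B. norm (snd (p + q) b)) \<le>
      (\<Sum>y\<in>Y. norm (fst p y)) + (\<Sum>y\<in>Y. norm (fst q y)) + \<Theta> * ((\<Sum>b\<in>B. norm (snd p b)) + (\<Sum>b\<in>B. norm (snd q b)))"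
      using \<Theta> by (intro add_mono mult_left_mono)
    from mult_left_mono[OF this C] show ?thesis unfolding N_def by (simp add: algebra_simps)
  qed
  moreover have "N (c *\<^sub>R p) = c * N p" if "c \<ge> 0" for c p
    using that unfolding N_def by (simp add: scaleR_fun_apply sum_distrib_left algebra_simps)
  ultimately obtain \<Lambda> where \<Lambda>: "linear \<Lambda>" "\<And>p. p \<in> S \<Longrightarrow> \<Lambda> p = \<tau> p" "\<And>p. \<Lambda> p \<le> N p"
    using hahn_banach_dominated[of N S \<tau>] by blast
  define T where "T u = (\<Sum>b\<in>B. \<Lambda> (0, (\<lambda>_. 0)(b := u)) *\<^sub>R b)" for u
  have T_lin: "linear T"
  proof -
    have "((0, (\<lambda>_. 0)(b := u + v)) :: ('a \<Rightarrow> 'a) \<times> ('a \<Rightarrow> 'a)) = (0, (\<lambda>_. 0)(b := u)) + (0, (\<lambda>_. 0)(b := v))"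
      "((0, (\<lambda>_. 0)(b := c *\<^sub>R u)) :: ('a \<Rightarrow> 'a) \<times> ('a \<Rightarrow> 'a)) = c *\<^sub>R (0, (\<lambda>_. 0)(b := u))" for b u v :: 'a and c
      by (auto simp: fun_eq_iff scaleR_fun_apply)
    then show ?thesis
      unfolding T_def
      by (intro linearI) (simp_all only: linear_add[OF \<Lambda>(1)] linear_scale[OF \<Lambda>(1)] scaleR_add_left sum.distrib scaleR_scaleR scaleR_sum_right real_scaleR_def)
  qed
  have T_id: "T w = w" if w: "w \<in> span W" for w
  proof -
    have wB: "w \<in> span B" using w W span_minimal[OF W subspace_span] by blast
    have "\<Lambda> (0, (\<lambda>_. 0)(b := w)) = \<theta> b w" if b: "b \<in> B" for b
    proof -
      have \<sigma>: "\<sigma> (0, (\<lambda>_. 0)(b := w)) c = (if c = b then w else 0)" for c unfolding \<sigma>_def by simp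
      then have "(0, (\<lambda>_. 0)(b := w)) \<in> S" unfolding S_def using w by (auto simp: span_zero)
      then have "\<Lambda> (0, (\<lambda>_. 0)(b := w)) = (\<Sum>c\<in>B. \<theta> c (if c = b then w else 0))" using \<Lambda>(2) unfolding \<tau>_def by (simp add: \<sigma>)
      also have "\<dots> = (\<Sum>c\<in>B. if c = b then \<theta> c w else 0)" by (intro sum.cong) (auto simp: linear_0[OF \<theta>(1)])
      finally show ?thesis using b B by simp
    qed
    then show ?thesis unfolding T_def using \<theta>(2)[OF wB] by (simp cong: sum.cong)
  qed
  have le: "f y (T u) \<le> C * norm u" if y: "y \<in> Y" for y u
  proof -
    define p :: "('a \<Rightarrow> 'a) \<times> ('a \<Rightarrow> 'a)" where "p = ((\<lambda>_. 0)(y := u), 0)"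
    \<comment> \<open>The pair \<open>q\<close> represents the zero family: \<open>f\<^sub>y \<otimes> u\<close> in the first component minus the same in the second.\<close>
    define q where "q = p - (\<Sum>b\<in>B. f y b *\<^sub>R (0, (\<lambda>_. 0)(b := u)))"
    have app: "(\<Sum>b\<in>D. g b) c = (\<Sum>b\<in>D. g b c)" for g :: "'a \<Rightarrow> 'a \<Rightarrow> 'a" and c :: 'a and D :: "'a set"
      by (induction D rule: infinite_finite_induct) auto
    have "\<sigma> q b = 0" if b: "b \<in> B" for b
    proof -
      have "(\<Sum>c\<in>B. f y c *\<^sub>R ((\<lambda>_. 0)(c := u)) b) = (\<Sum>c\<in>B. if c = b then f y b *\<^sub>R u else 0)"
        by (intro sum.cong) auto
      then have "(\<Sum>c\<in>B. f y c *\<^sub>R ((\<lambda>_. 0)(c := u)) b) = f y b *\<^sub>R u" using b B by simp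
      moreover have "(\<Sum>c\<in>Y. f c b *\<^sub>R ((\<lambda>_. 0)(y := u)) c) = (\<Sum>c\<in>Y. if c = y then f y b *\<^sub>R u else 0)"
        by (intro sum.cong) auto
      ultimately show ?thesis
        using y Y unfolding \<sigma>_def q_def p_def
        by (simp add: fst_sum snd_sum app scaleR_fun_apply)
    qed
    then have "q \<in> S" "\<tau> q = 0" unfolding S_def \<tau>_def by (auto simp: span_zero linear_0[OF \<theta>(1)])
    then have "\<Lambda> q = 0" using \<Lambda>(2) by simp
    then have "\<Lambda> p = (\<Sum>b\<in>B. f y b * \<Lambda> (0, (\<lambda>_. 0)(b := u)))"
      unfolding q_def by (simp add: linear_diff[OF \<Lambda>(1)] linear_sum[OF \<Lambda>(1)] linear_scale[OF \<Lambda>(1)] del: scaleR_Pair)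
    also have "\<dots> = f y (T u)"
      unfolding T_def by (simp add: linear_sum[OF f] linear_scale[OF f] mult.commute)
    finally have "f y (T u) \<le> N p" using \<Lambda>(3)[of p] by simp
    moreover have "(\<Sum>c\<in>Y. norm (((\<lambda>_. 0)(y := u)) c)) = (\<Sum>c\<in>Y. if c = y then norm u else 0)"
      by (intro sum.cong) auto
    ultimately show ?thesis using y Y unfolding N_def p_def by simp
  qed
  have "\<bar>f y (T u)\<bar> \<le> C * norm u" if "y \<in> Y" for y u
    using le[OF that, of u] le[OF that, of "-u"] by (simp add: linear_neg[OF T_lin] linear_neg[OF f] abs_le_iff)
  moreover have "range T \<subseteq> span B" unfolding T_def by (auto intro: span_sum span_scale span_base)
  ultimately show ?thesis using T_lin T_id by blast
qed

section \<open>Operators that fix a given subspace\<close>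

lemma interior_ball_in_span:
  assumes "top_of_set (span W) interior_of (K \<inter> span W) \<noteq> ({} :: 'a::real_normed_vector set)"
  shows "\<exists>y r. r > 0 \<and> (\<forall>z\<in>span W. norm z \<le> r \<longrightarrow> y + z \<in> K)"
proof -
  obtain y U where y: "y \<in> U" "openin (top_of_set (span W)) U" "U \<subseteq> K \<inter> span W"
    using assms unfolding interior_of_def by blast
  then obtain d where d: "d > 0" "\<And>x. x \<in> span W \<Longrightarrow> dist x y < d \<Longrightarrow> x \<in> U"
    unfolding openin_euclidean_subtopology_iff by blast
  have "y + z \<in> K" if "z \<in> span W" "norm z \<le> d / 2" for z
  proof -
    have "y + z \<in> span W" using that y by (auto intro: span_add)
    then show ?thesis using d(2)[of "y + z"] that y d(1) by (auto simp: dist_norm)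
  qed
  then show ?thesis using d(1) by (intro exI[of _ y] exI[of _ "d/2"]) auto
qed

lemma flat_near_initial_span:
  fixes K :: "'a::real_normed_vector set"
  assumes K: "bounded K" and a: "a > 0"
    and lim: "liminf (\<lambda>n. ereal (height e K n * a ^ n)) = 0" and c: "c > 0"
  shows "\<exists>n\<ge>m. \<forall>x\<in>K. \<exists>t\<in>initial_span e n. norm (x - t) < c / a ^ n"
proof -
  obtain n where n: "n \<ge> m" "height e K n * a ^ n < c"
  proof -
    have "\<not> eventually (\<lambda>n. ereal c \<le> ereal (height e K n * a ^ n)) sequentially"
    proof
      assume "eventually (\<lambda>n. ereal c \<le> ereal (height e K n * a ^ n)) sequentially"
      from Liminf_bounded[OF this] show False using lim c by simp
    qed
    then show ?thesis using that unfolding eventually_sequentially by (auto simp: not_le)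
  qed
  have "\<exists>t\<in>initial_span e n. norm (x - t) < c / a ^ n" if x: "x \<in> K" for x
  proof -
    have ne: "initial_span e n \<noteq> {}" unfolding initial_span_def using span_zero by blast
    obtain \<rho> where \<rho>: "\<And>x. x \<in> K \<Longrightarrow> norm x \<le> \<rho>" using K by (auto simp: bounded_iff)
    have "infdist x (initial_span e n) \<le> \<rho>" if "x \<in> K" for x
      using infdist_le[of 0 "initial_span e n" x] \<rho>[OF that] unfolding initial_span_def by (simp add: span_zero)
    then have "bdd_above ((\<lambda>x. infdist x (initial_span e n)) ` K)" by (rule bdd_aboveI2)
    then have "infdist x (initial_span e n) \<le> height e K n"
      unfolding height_def by (rule cSUP_upper2[OF _ x order_refl])
    also have "\<dots> < c / a ^ n" using n(2) a by (simp add: pos_less_divide_eq)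
    finally have "(INF t\<in>initial_span e n. dist x t) < c / a ^ n" using ne by (simp add: infdist_notempty)
    then show ?thesis
      using ne by (subst (asm) cINF_less_iff) (auto simp: dist_norm intro: bdd_belowI[of _ 0])
  qed
  then show ?thesis using n(1) by blast
qed

text \<open>
  A functional that norms a point of the net still has value at least \<open>1 - \<delta>\<close> at unit vectors at distance less
  than \<open>\<delta>\<close> from that point.
\<close>

lemma norm_le_of_norming_net:
  assumes A: "\<And>x. x \<in> E \<Longrightarrow> norm x = 1 \<Longrightarrow> \<exists>y\<in>Y. norm (x - y) < \<delta>" and E: "subspace E"
    and Y: "\<And>y. y \<in> Y \<Longrightarrow> norm y = 1"
    and f: "\<And>y. linear (f y)" "\<And>y x. \<bar>f y x\<bar> \<le> norm x" "\<And>y. f y y = norm y"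
    and x: "x \<in> E" and c: "c \<ge> 0" and le: "\<And>y. y \<in> Y \<Longrightarrow> \<bar>f y x\<bar> \<le> c"
  shows "(1 - \<delta>) * norm (x :: 'a::real_normed_vector) \<le> c"
proof (cases "x = 0")
  case False
  define u where "u = (1 / norm x) *\<^sub>R x"
  have u: "u \<in> E" "norm u = 1" using x False E unfolding u_def by (auto intro: subspace_scale)
  obtain y where y: "y \<in> Y" "norm (u - y) < \<delta>" using A[OF u] by blast
  have "1 - \<delta> \<le> f y u"
    using f(2)[of y "u - y"] f(3)[of y] Y[OF y(1)] y(2) by (simp add: linear_diff[OF f(1)])
  also have "f y u = f y x / norm x" unfolding u_def by (simp add: linear_scale[OF f(1)])
  finally show ?thesis using le[OF y(1)] False by (simp add: pos_le_divide_eq)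
qed (use c in simp)

text \<open>
  The radius \<open>r\<close>, the coordinate bound \<open>\<kappa>\<close> and the constant \<open>c\<close> built from them belong to
  \<open>initial_span e m\<close>. The index \<open>n\<close> is chosen afterwards, so that \<open>K\<close> is within
  distance \<open>H = c / (3 + \<epsilon>)\<^sup>n\<close> of \<open>initial_span e n\<close>. There are
  at most \<open>(3 + \<epsilon>/2)\<^sup>n + n\<close> directions, whence \<open>H\<close> times their number is at most \<open>2c\<close>.
\<close>

lemma operator_fixing_initial_span:
  fixes K :: "'a::banach set" and e :: "nat \<Rightarrow> 'a"
  assumes lip: "L-lipschitz_on UNIV R" and RK: "\<And>x. R x \<in> K" and fixK: "\<And>x. x \<in> K \<Longrightarrow> R x = x"
    and K: "bounded K" and \<epsilon>: "\<epsilon> > 0"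
    and lim: "liminf (\<lambda>n. ereal (height e K n * (3 + \<epsilon>) ^ n)) = 0"
    and int: "top_of_set (initial_span e m) interior_of (K \<inter> initial_span e m) \<noteq> {}"
  shows "\<exists>T n. linear T \<and> range T \<subseteq> initial_span e n \<and> (\<forall>x\<in>initial_span e m. T x = x) \<and>
           (\<forall>x. norm (T x) \<le> (L + 2) * (4 + \<epsilon>) / \<epsilon> * norm x)"
proof -
  have L0: "L \<ge> 0" using lip by (rule lipschitz_on_nonneg)
  \<comment> \<open>The solution of \<open>1 + 2/\<delta> = 3 + \<epsilon>/2\<close>.\<close>
  define \<delta> where "\<delta> = 4 / (4 + \<epsilon>)"
  have \<delta>: "\<delta> > 0" "1 + 2 / \<delta> = 3 + \<epsilon> / 2" "1 - \<delta> = \<epsilon> / (4 + \<epsilon>)"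
    using \<epsilon> unfolding \<delta>_def by (auto simp: field_simps)
  define W where "W = e ` {1..m}"
  have W: "finite W" unfolding W_def by simp
  obtain y0 r where r: "r > 0" "\<And>z. z \<in> span W \<Longrightarrow> norm z \<le> r \<Longrightarrow> y0 + z \<in> K"
    using interior_ball_in_span int unfolding initial_span_def W_def by metis
  obtain \<omega> \<kappa> where \<omega>: "\<kappa> \<ge> 0" "\<And>w. bounded_linear (\<omega> w :: 'a \<Rightarrow> real)" "\<And>w x. w \<in> W \<Longrightarrow> \<bar>\<omega> w x\<bar> \<le> \<kappa> * norm x"
      "\<And>x. x \<in> span W \<Longrightarrow> (\<Sum>w\<in>W. \<omega> w x *\<^sub>R w) = x"
    using bounded_coordinates_uniform[OF W] by metis
  note \<omega>' = bounded_linear.linear[OF \<omega>(2)]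
  define r' where "r' = r / ((\<Sum>w\<in>W. norm w) + 1)"
  have sn: "(\<Sum>w\<in>W. norm w) \<ge> 0" by (simp add: sum_nonneg)
  have r': "r' > 0" "r' * (\<Sum>w\<in>W. norm w) \<le> r"
    using r(1) sn unfolding r'_def by (auto simp: field_simps)
  \<comment> \<open>Small enough that the deviation \<open>\<eta>\<close> of \<open>T\<close> from the identity on \<open>W\<close> contributes at
    most one to the constant of the trace inequality.\<close>
  define c where "c = r' / ((card W * \<kappa> + 1) * (4 * L + 2))"
  have cpos: "(card W * \<kappa> + 1) * (4 * L + 2) > 0" using L0 \<omega>(1) by (intro mult_pos_pos add_nonneg_pos mult_nonneg_nonneg) auto
  have c: "c > 0" using r'(1) cpos unfolding c_def by simp
  define \<eta> where "\<eta> = c * (4 * L + 2) / r'"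
  have \<eta>: "card W * \<kappa> * \<eta> \<le> 1"
  proof -
    have "\<eta> = 1 / (card W * \<kappa> + 1)" unfolding \<eta>_def c_def using r'(1) L0 by simp
    moreover have "card W * \<kappa> \<ge> 0" using \<omega>(1) by simp
    ultimately show ?thesis by (simp add: divide_le_eq_1)
  qed
  have "3 + \<epsilon> > 0" using \<epsilon> by simp
  from flat_near_initial_span[OF K this lim c, of m] obtain n where n: "n \<ge> m"
      "\<And>x. x \<in> K \<Longrightarrow> \<exists>t\<in>initial_span e n. norm (x - t) < c / (3 + \<epsilon>) ^ n" by blast
  define H where "H = c / (3 + \<epsilon>) ^ n"
  have H: "H > 0" using c \<epsilon> unfolding H_def by simp
  define B where "B = e ` {1..n}"
  have B: "finite B" "card B \<le> n" unfolding B_def using card_image_le[of "{1..n}" e] by auto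
  have WB: "W \<subseteq> span B" using n(1) unfolding W_def B_def by (auto intro!: span_base)
  obtain \<theta> \<Theta> where \<theta>: "\<Theta> \<ge> 0" "\<And>b. bounded_linear (\<theta> b :: 'a \<Rightarrow> real)" "\<And>b x. b \<in> B \<Longrightarrow> \<bar>\<theta> b x\<bar> \<le> \<Theta> * norm x"
      "\<And>x. x \<in> span B \<Longrightarrow> (\<Sum>b\<in>B. \<theta> b x *\<^sub>R b) = x"
    using bounded_coordinates_uniform[OF B(1)] by metis
  note \<theta>' = bounded_linear.linear[OF \<theta>(2)]
  obtain Y where Y: "Y \<subseteq> span B \<inter> sphere 0 1" "finite Y" "real (card Y) \<le> (1 + 2 / \<delta>) ^ card B"
      "\<And>x. x \<in> span B \<inter> sphere 0 1 \<Longrightarrow> \<exists>y\<in>Y. norm (x - y) < \<delta>"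
  proof -
    have "span B \<inter> sphere 0 1 \<subseteq> cball 0 1" by auto
    from finite_net[OF B(1) \<delta>(1) _ this] show ?thesis using that by blast
  qed
  have "\<exists>\<phi>. linear \<phi> \<and> (\<forall>x. \<bar>\<phi> x\<bar> \<le> norm x) \<and> \<phi> y = norm y" for y :: 'a
    using norming_functional[of y] by (cases "y = 0") (auto intro!: exI[of _ "\<lambda>_. 0"] simp: linear_iff)
  then obtain f :: "'a \<Rightarrow> 'a \<Rightarrow> real" where f: "\<And>y. linear (f y)" "\<And>y x. \<bar>f y x\<bar> \<le> norm x" "\<And>y. f y y = norm y"
    by metis
  have count: "H * (card Y + card B) \<le> 2 * c"
  proof -
    have "real (card Y) \<le> (3 + \<epsilon>) ^ n"
    proof -
      have "real (card Y) \<le> (3 + \<epsilon> / 2) ^ card B" using Y(3) \<delta>(2) by simp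
      also have "\<dots> \<le> (3 + \<epsilon> / 2) ^ n" using B(2) \<epsilon> by (intro power_increasing) auto
      also have "\<dots> \<le> (3 + \<epsilon>) ^ n" using \<epsilon> by (intro power_mono) auto
      finally show ?thesis .
    qed
    moreover have "real (card B) \<le> (3 + \<epsilon>) ^ n"
    proof -
      have "real (card B) \<le> 2 ^ n" using B(2) less_exp[of n] by (metis le_less_trans less_imp_le of_nat_le_numeral_power_cancel_iff)
      also have "\<dots> \<le> (3 + \<epsilon>) ^ n" using \<epsilon> by (intro power_mono) auto
      finally show ?thesis .
    qed
    ultimately have "card Y + real (card B) \<le> 2 * (3 + \<epsilon>) ^ n" by linarith
    from mult_left_mono[OF this, of H] show ?thesis using H \<epsilon> unfolding H_def by simp
  qed
  have Hc: "H \<le> c" unfolding H_def using \<epsilon> c by (simp add: divide_le_eq_1 field_simps)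
  have trace: "(\<Sum>b\<in>B. \<theta> b (r b + (\<Sum>y\<in>Y. f y b *\<^sub>R x y))) \<le> (L + 2) * ((\<Sum>y\<in>Y. norm (x y)) + \<Theta> * (\<Sum>b\<in>B. norm (r b)))"
    if z: "\<And>b. b \<in> B \<Longrightarrow> r b + (\<Sum>y\<in>Y. f y b *\<^sub>R x y) \<in> span W" for x r
  proof -
    \<comment> \<open>Normalised directions; the zero vector is harmless because \<open>sgn 0 = 0\<close>.\<close>
    define V where "V = (\<lambda>y. sgn (x y)) ` Y \<union> (\<lambda>b. sgn (r b)) ` B"
    have V: "finite V" "\<And>v. v \<in> V \<Longrightarrow> norm v \<le> 1" unfolding V_def using Y(2) B(1) by (auto simp: norm_sgn)
    have cV: "card V \<le> card Y + card B"
      unfolding V_def using card_Un_le card_image_le[OF Y(2)] card_image_le[OF B(1)] by (meson add_mono order_trans)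
    have near: "\<And>x. x \<in> K \<Longrightarrow> \<exists>t\<in>span B. norm (x - t) < H"
      using n(2) unfolding initial_span_def B_def H_def .
    obtain T where T: "linear T" "\<And>u. u \<in> V \<union> W \<Longrightarrow> T u \<in> span B" "\<And>v. v \<in> V \<Longrightarrow> norm (T v) \<le> L + 1"
        "\<And>w. w \<in> W \<Longrightarrow> norm (T w - w) \<le> (L * (2 * H * card V) + 2 * H) / r'"
      using linear_from_retraction[OF lip RK fixK B(1) K H near V W r(1) r' r(2)] by blast
    have "(L * (2 * H * card V) + 2 * H) / r' \<le> \<eta>"
    proof -
      have "H * card V \<le> H * (card Y + card B)" using cV H by (intro mult_left_mono) auto
      then have "2 * H * card V \<le> 4 * c" using count by simp
      then have "L * (2 * H * card V) \<le> L * (4 * c)" using L0 by (rule mult_left_mono)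
      then show ?thesis unfolding \<eta>_def using Hc r'(1) by (intro divide_right_mono) (auto simp: algebra_simps)
    qed
    then have T4: "norm (T w - w) \<le> \<eta>" if "w \<in> W" for w using T(4)[OF that] by linarith
    have sgn: "T u = norm u *\<^sub>R T (sgn u)" for u
      by (cases "u = 0") (simp_all add: linear_0[OF T(1)] linear_scale[OF T(1)] sgn_div_norm)
    have Tu: "T u \<in> span B" "norm (T u) \<le> (L + 1) * norm u" if "sgn u \<in> V" for u
      using T(2)[of "sgn u"] T(3)[OF that] that mult_left_mono[OF T(3)[OF that], of "norm u"]
      by (simp_all add: sgn[of u] span_scale mult.commute)
    have "(\<Sum>b\<in>B. \<theta> b (r b + (\<Sum>y\<in>Y. f y b *\<^sub>R x y))) \<le> (L + 1 + card W * \<kappa> * \<eta>) * ((\<Sum>y\<in>Y. norm (x y)) + \<Theta> * (\<Sum>b\<in>B. norm (r b)))"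
      by (rule trace_estimate[OF B(1) W WB Y(2) \<theta>' \<theta>(4) \<theta>(3) \<theta>(1) \<omega>' \<omega>(4) \<omega>(3) \<omega>(1) f(1) f(2) T(1)])
         (use Tu T(2) T4 z in \<open>auto simp: V_def\<close>)
    also have "\<dots> \<le> (L + 2) * ((\<Sum>y\<in>Y. norm (x y)) + \<Theta> * (\<Sum>b\<in>B. norm (r b)))"
      using \<eta> \<theta>(1) by (intro mult_right_mono add_nonneg_nonneg mult_nonneg_nonneg sum_nonneg) auto
    finally show ?thesis .
  qed
  have L2: "L + 2 \<ge> 0" using L0 by simp
  obtain T where T: "linear T" "range T \<subseteq> span B" "\<And>w. w \<in> span W \<Longrightarrow> T w = w"
      "\<And>y u. y \<in> Y \<Longrightarrow> \<bar>f y (T u)\<bar> \<le> (L + 2) * norm u"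
    using operator_from_trace_estimate[OF B(1) WB Y(2) \<theta>' \<theta>(4) \<theta>(1) L2 f(1) trace] by blast
  have "norm (T x) \<le> (L + 2) * (4 + \<epsilon>) / \<epsilon> * norm x" for x
  proof -
    have "(1 - \<delta>) * norm (T x) \<le> (L + 2) * norm x"
      by (rule norm_le_of_norming_net[where E="span B" and Y=Y and f=f])
         (use Y T f L2 in auto)
    then show ?thesis unfolding \<delta>(3) using \<epsilon> by (simp add: field_simps)
  qed
  then show ?thesis using T unfolding initial_span_def W_def B_def by blast
qed

section \<open>The bounded approximation property\<close>

lemma initial_span_mono: "m \<le> n \<Longrightarrow> initial_span e m \<subseteq> initial_span e n"
  unfolding initial_span_def by (intro span_mono image_mono) auto

lemma in_initial_span:
  assumes "y \<in> span (e ` {1..})"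
  shows "\<exists>m\<ge>1. y \<in> initial_span e m"
proof -
  obtain t where t: "finite t" "t \<subseteq> e ` {1..}" "y \<in> span t"
    using assms unfolding span_explicit by blast
  then obtain N where N: "finite N" "N \<subseteq> {1..}" "t = e ` N" by (metis finite_subset_image)
  define m where "m = Max (insert 1 N)"
  have "N \<subseteq> {1..m}" using N unfolding m_def by auto
  then have "y \<in> initial_span e m" using t(3) span_mono[of t "e ` {1..m}"] unfolding initial_span_def N(3) by auto
  moreover have "m \<ge> 1" unfolding m_def using N(1) by simp
  ultimately show ?thesis by blast
qed

theorem theorem2p6:
  fixes K :: "'a::banach set" and e :: "nat \<Rightarrow> 'a"
  assumes "generating K"
    and "\<forall>n\<ge>1. e n \<in> span K"
    and "fundamental e"
    and "flat e K"
    and "nonempty_local_interior e K"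
    and "\<exists>R. lipschitz_retraction R K"
  shows "bounded_approximation_property TYPE('a)"
proof -
  obtain \<epsilon> where K: "bounded K" and \<epsilon>: "\<epsilon> > 0" "liminf (\<lambda>n. ereal (height e K n * (3 + \<epsilon>) ^ n)) = 0"
    using assms(4) unfolding flat_def by blast
  obtain R L where R: "\<And>x. R x \<in> K" "\<And>x. x \<in> K \<Longrightarrow> R x = x" "L-lipschitz_on UNIV R"
    using assms(6) unfolding lipschitz_retraction_def by blast
  define C where "C = (L + 2) * (4 + \<epsilon>) / \<epsilon>"
  have C: "C \<ge> 0" unfolding C_def using \<epsilon>(1) lipschitz_on_nonneg[OF R(3)] by simp
  have "\<exists>S. finite_rank S \<and> norm S \<le> C \<and> (\<forall>x\<in>initial_span e m. blinfun_apply S x = x)" if m: "m \<in> {1..}" for m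
  proof -
    obtain T n where T: "linear T" "range T \<subseteq> initial_span e n" "\<And>x. x \<in> initial_span e m \<Longrightarrow> T x = x"
      "\<And>x. norm (T x) \<le> C * norm x"
      using operator_fixing_initial_span[OF R(3,1,2) K \<epsilon>, of m] assms(5) m
      unfolding nonempty_local_interior_def C_def by auto
    have bl: "bounded_linear T"
      using T(1,4) by (intro bounded_linear_intro[of _ C]) (auto simp: linear_add linear_scale mult.commute)
    have "finite_rank (Blinfun T)"
      unfolding finite_rank_def using T(2)
      by (intro exI[of _ "e ` {1..n}"]) (simp add: bounded_linear_Blinfun_apply[OF bl] initial_span_def)
    moreover have "norm (Blinfun T) \<le> C"
      by (rule norm_blinfun_bound[OF C]) (simp add: bounded_linear_Blinfun_apply[OF bl] T(4))
    ultimately show ?thesis using T(3) by (metis bounded_linear_Blinfun_apply[OF bl])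
  qed
  then obtain S where S: "\<And>m. m \<in> {1..} \<Longrightarrow> finite_rank (S m)" "\<And>m. m \<in> {1..} \<Longrightarrow> norm (S m) \<le> C"
      "\<And>m x. m \<in> {1..} \<Longrightarrow> x \<in> initial_span e m \<Longrightarrow> blinfun_apply (S m) x = x"
    by metis
  have "net_tendsto {1..} (\<le>) (\<lambda>m. blinfun_apply (S m) x) x" for x
    unfolding net_tendsto_def
  proof (intro allI impI)
    fix U assume "open U \<and> x \<in> U"
    then obtain d where d: "d > 0" "ball x d \<subseteq> U" using open_contains_ball by blast
    have "x \<in> closure (span (e ` {1..}))" using assms(3) unfolding fundamental_def by simp
    moreover have "d / (C + 1) > 0" using d(1) C by simp
    ultimately obtain y where y: "y \<in> span (e ` {1..})" "dist y x < d / (C + 1)"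
      unfolding closure_approachable by blast
    obtain m where m: "m \<ge> 1" "y \<in> initial_span e m" using in_initial_span[OF y(1)] by blast
    have "blinfun_apply (S j) x \<in> U" if j: "j \<in> {1..}" "m \<le> j" for j
    proof -
      have "blinfun_apply (S j) y = y" using S(3)[OF j(1)] m(2) initial_span_mono[OF j(2)] by blast
      then have "x - blinfun_apply (S j) x = (x - y) - blinfun_apply (S j) (x - y)"
        by (simp add: blinfun.diff_right)
      moreover have "norm (blinfun_apply (S j) (x - y)) \<le> C * norm (x - y)"
        using norm_blinfun[of "S j" "x - y"] mult_right_mono[OF S(2)[OF j(1)], of "norm (x - y)"] by simp
      ultimately have "norm (x - blinfun_apply (S j) x) \<le> (C + 1) * norm (x - y)"
        using norm_triangle_ineq4[of "x - y" "blinfun_apply (S j) (x - y)"] by (simp add: algebra_simps)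
      also have "\<dots> < d" using y(2) C by (simp add: dist_norm norm_minus_commute pos_less_divide_eq mult.commute)
      finally show ?thesis using d(2) by (auto simp: dist_norm)
    qed
    then show "\<exists>i\<in>{1..}. \<forall>j\<in>{1..}. i \<le> j \<longrightarrow> blinfun_apply (S j) x \<in> U" using m(1) by auto
  qed
  moreover have "directed_set {1::nat..} (\<le>)"
    unfolding directed_set_def
  proof (intro conjI ballI)
    fix i j :: nat assume "i \<in> {1..}" "j \<in> {1..}"
    then show "\<exists>k\<in>{1..}. i \<le> k \<and> j \<le> k" by (intro bexI[of _ "max i j"]) auto
  qed (auto simp: reflp_on_def transp_on_def)
  ultimately have "bap_net {1..} (\<le>) S"
    unfolding bap_net_def using S(1,2) by blast
  then show ?thesis by (rule bapI)
qed

end
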